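(* Let $p$ be a prime, let $A,B \subset \mathbb{Z}_{p}$, and let $\beta,\epsilon \in (0,1]$. Assume that $|B| > p^{\beta} > 4$. Then there exist an integer \[ k \leq \exp\big(C\max\{1/\beta,1/\epsilon\}\big), \] elements $a_{1},\ldots,a_{k} \in A$, and a choice of signs $\pm \in \{-,+\}$ such that \[ |a_{1}B \pm a_{2}B \pm \ldots \pm a_{k}B| \geq c\,p^{-\epsilon}\min\{|A||B|,p\}. \] Here $c \geq 2^{-12}$ and $C \leq 122$ are absolute constants (in particular, the statement holds with $c = 2^{-12}$ and $C = 122$).
   Context: $\mathbb{Z}_{p}$ denotes the field with $p$ elements. For $a \in \mathbb{Z}_{p}$ and $X \subset \mathbb{Z}_{p}$, $aX = \{ax : x \in X\}$. Sums and differences of sets are sumsets: $X \pm Y = \{x \pm y : x \in X, y \in Y\}$. $|X|$ denotes cardinality.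
   Formalization: The formal theorem assumes in addition that A contains a nonzero element; the claim as written fails for A = {0} (take B = Z_p, β = ε = 1/2, p > 2^24, where every sum is {0}), and for empty A there is no a_1. *)

theory Defs
  imports
    Complex_Main
    "HOL-Library.Set_Algebras"
    "Berlekamp_Zassenhaus.Finite_Field"
begin

text \<open>
  The field with \<open>p\<close> elements is \<open>'p mod_ring\<close> with \<open>'p :: prime_card\<close> and \<open>p = CARD('p)\<close>.
  The dilate \<open>a *o X\<close> and the sumset \<open>X + Y\<close> are those of \<^theory>\<open>HOL-Library.Set_Algebras\<close>.
  On sets, \<open>X - Y\<close> is the relative complement, so the difference set needs its own name.
\<close>

definition diffset :: "'a::minus set \<Rightarrow> 'a set \<Rightarrow> 'a set" where
  "diffset X Y = {x - y | x y. x \<in> X \<and> y \<in> Y}"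

datatype sign = Plus | Minus

text \<open>
  \<open>signed_sumset a s B k\<close> is the set \<open>a 1 B \<plusminus> a 2 B \<plusminus> \<dots> \<plusminus> a k B\<close>, associated to the left,
  where \<open>s i\<close> is the sign in front of \<open>a i B\<close> for \<open>2 \<le> i \<le> k\<close>; the first term carries no sign.
  The value at \<open>k = 0\<close> is the usual empty sum.
\<close>

fun signed_sumset :: "(nat \<Rightarrow> 'a::ring) \<Rightarrow> (nat \<Rightarrow> sign) \<Rightarrow> 'a set \<Rightarrow> nat \<Rightarrow> 'a set" where
  "signed_sumset a s B 0 = {0}"
| "signed_sumset a s B (Suc 0) = a 1 *o B"
| "signed_sumset a s B (Suc (Suc n)) =
    (case s (Suc (Suc n)) of
       Plus \<Rightarrow> signed_sumset a s B (Suc n) + a (Suc (Suc n)) *o B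
     | Minus \<Rightarrow> diffset (signed_sumset a s B (Suc n)) (a (Suc (Suc n)) *o B))"

end

theory Submission
  imports Defs
begin

text \<open>
  Greedy choices produce a signed sum \<open>A'\<close> of copies of \<open>A\<close> that hardly grows when
  \<open>\<plusminus>A\<close> is added, and then a long sum \<open>H\<close> of dilates \<open>\<plusminus>aB\<close> that hardly grows
  when any \<open>tB\<close> with \<open>t \<in> A' \<union> A \<union> -A\<close> is added. The second property says that \<open>h - t(b - b0)\<close>
  often lies in \<open>H\<close>; dependent random choice turns this into a dense \<open>B' \<subseteq> B\<close> such that for any few
  \<open>b \<in> B'\<close> a large common part of \<open>H\<close> hardly grows when the sets \<open>\<plusminus>(b - b0)A\<close> are added.
  By a Plunnecke inequality, any short sum of sets \<open>\<plusminus>aB\<close> and \<open>\<plusminus>(b - b0)A\<close> is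
  then not much larger than \<open>H\<close>.

  A large set of this form comes from Dyson's e-transform, used additively:
  replace \<open>(T, U)\<close> by \<open>T' = {t \<in> T. z - xt \<in> U}\<close> and \<open>U' = U + xT\<close>, where \<open>x\<close> is a quotient of
  differences of \<open>U\<close> and \<open>T\<close> and \<open>z\<close> is a popular value. This never decreases \<open>|T||U|\<close>.
  Since the prime field is generated by any nonzero element, some \<open>x\<close> gives
  \<open>|U'| \<ge> |T| powr (1/2) |U| / 2\<close> or \<open>|U'| \<ge> p/2\<close>. Starting at \<open>(A, B')\<close>, the ratio
  \<open>|A||B'|/|U|\<close> is essentially replaced by its square root at each step, while the number of
  summands doubles.
\<close>

subsection \<open>A Plunnecke inequality for several summands\<close>

lemma card_translate: "card ((z::'a::ab_group_add) +o X) = card X"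
proof -
  have "z +o X = (+) z ` X" by (auto simp: elt_set_plus_def)
  then show ?thesis by (simp add: card_image)
qed

lemma card_le_card_plus:
  fixes X C :: "'a::{ab_group_add,finite} set"
  assumes "C \<noteq> {}"
  shows "card X \<le> card (X + C)"
proof -
  obtain c where "c \<in> C" using assms by auto
  then have "c +o X \<subseteq> X + C"
    by (auto simp: elt_set_plus_def set_plus_def add.commute)
  then have "card (c +o X) \<le> card (X + C)" by (rule card_mono[OF finite])
  then show ?thesis by (simp add: card_translate)
qed

text \<open>Petridis' argument, with a family of sets in place of one. A new element
  \<open>z\<close> adds to \<open>X + Z\<close> a translate of \<open>X - W\<close>, where
  \<open>W\<close> is the part of \<open>X\<close> whose shift by \<open>z\<close> was there
  already. As \<open>W + C + z\<close> lies in \<open>X + C + Z\<close>, this set gains at most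
  \<open>card (X + C) - card (W + C)\<close> elements; minimality applied to \<open>W\<close>
  compares the two gains.\<close>

lemma Petridis_sum:
  fixes X :: "'a::{ab_group_add,finite} set" and \<C> :: "'a set set" and \<rho> :: real
  assumes min: "\<And>Y. Y \<subseteq> X \<Longrightarrow> Y \<noteq> {} \<Longrightarrow> \<rho> * card Y \<le> (\<Sum>C\<in>\<C>. real (card (Y + C)))"
    and eq: "(\<Sum>C\<in>\<C>. real (card (X + C))) = \<rho> * card X"
  shows "(\<Sum>C\<in>\<C>. real (card (X + C + Z))) \<le> \<rho> * card (X + Z)"
proof (induction Z rule: finite_induct[OF finite])
  case 1
  have "X + {} = {}" "\<And>C. X + C + {} = {}" by (auto simp: set_plus_def)
  then show ?case by simp
next
  case (2 z Z)
  define W where "W = {x \<in> X. x + z \<in> X + Z}"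
  have W: "W \<subseteq> X" by (auto simp: W_def)
  have XZ: "X + insert z Z = (X + Z) \<union> (z +o (X - W))"
    by (auto simp: W_def set_plus_def elt_set_plus_def add.commute)
  have "(X + Z) \<inter> (z +o (X - W)) = {}"
    by (auto simp: W_def elt_set_plus_def add.commute)
  then have cXZ: "real (card (X + insert z Z)) = card (X + Z) + (real (card X) - card W)"
    unfolding XZ using W card_mono[OF finite W]
    by (subst card_Un_disjoint) (auto simp: card_translate card_Diff_subset)
  have step: "real (card (X + C + insert z Z)) \<le> card (X + C + Z) + (real (card (X + C)) - card (W + C))" for C
  proof -
    have "W + C \<subseteq> X + C" using W by (auto simp: set_plus_def)
    have "X + C + insert z Z \<subseteq> (X + C + Z) \<union> (z +o ((X + C) - (W + C)))"
    proof
      fix y assume "y \<in> X + C + insert z Z"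
      then obtain v u where v: "v \<in> X + C" and u: "u \<in> insert z Z" and y: "y = v + u"
        by (auto elim!: set_plus_elim)
      show "y \<in> (X + C + Z) \<union> (z +o ((X + C) - (W + C)))"
      proof (cases "u \<in> Z")
        case True then show ?thesis using v y by blast
      next
        case False
        then have uz: "u = z" using u by simp
        show ?thesis
        proof (cases "v \<in> W + C")
          case True
          then obtain w c where wc: "w \<in> W" "c \<in> C" "v = w + c" by (auto elim!: set_plus_elim)
          then have "w + z \<in> X + Z" by (simp add: W_def)
          then obtain x u' where "x \<in> X" "u' \<in> Z" "w + z = x + u'" by (elim set_plus_elim)
          have "y = (w + z) + c" using wc uz y by (simp add: ac_simps)
          then have "y = x + c + u'" using \<open>w + z = x + u'\<close> by (simp add: ac_simps)
          then show ?thesis using \<open>x \<in> X\<close> \<open>c \<in> C\<close> \<open>u' \<in> Z\<close> by blast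
        next
          case False
          then have "z + v \<in> z +o ((X + C) - (W + C))" using v by (intro set_plus_intro2) simp
          then show ?thesis using y uz by (simp add: add.commute)
        qed
      qed
    qed
    then have "card (X + C + insert z Z) \<le> card ((X + C + Z) \<union> (z +o ((X + C) - (W + C))))"
      by (rule card_mono[OF finite])
    also have "\<dots> \<le> card (X + C + Z) + card (z +o ((X + C) - (W + C)))"
      by (rule card_Un_le)
    also have "card (z +o ((X + C) - (W + C))) = card (X + C) - card (W + C)"
      using \<open>W + C \<subseteq> X + C\<close> by (simp add: card_translate card_Diff_subset)
    finally show ?thesis using card_mono[OF finite \<open>W + C \<subseteq> X + C\<close>] by linarith
  qed
  have "\<rho> * card W \<le> (\<Sum>C\<in>\<C>. real (card (W + C)))"
    using min[OF W] by (cases "W = {}") (auto intro: sum_nonneg)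
  moreover have "(\<Sum>C\<in>\<C>. real (card (X + C + insert z Z))) \<le>
      (\<Sum>C\<in>\<C>. card (X + C + Z) + (real (card (X + C)) - card (W + C)))"
    by (intro sum_mono step)
  moreover have "\<dots> = (\<Sum>C\<in>\<C>. real (card (X + C + Z))) + (\<rho> * card X - (\<Sum>C\<in>\<C>. real (card (W + C))))"
    by (simp add: sum.distrib sum_subtractf eq)
  ultimately show ?case
    using 2(3) unfolding cXZ distrib_left right_diff_distrib by linarith
qed

text \<open>
  Minimising the sum of the ratios \<open>|X + C| / |X|\<close> gives one \<open>X\<close> that serves all \<open>C\<close>.
  As every ratio is at least 1, each single one exceeds 1 by at most the total excess.
\<close>

lemma simultaneous_Plunnecke:
  fixes H :: "'a::{ab_group_add,finite} set" and \<alpha> :: real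
  assumes "H \<noteq> {}" and ne: "\<And>C. C \<in> \<C> \<Longrightarrow> C \<noteq> {}"
    and small: "\<And>C. C \<in> \<C> \<Longrightarrow> real (card (H + C)) \<le> \<alpha> * card H"
  obtains X where "X \<subseteq> H" "X \<noteq> {}"
    "\<And>C Z. C \<in> \<C> \<Longrightarrow> real (card (X + C + Z)) \<le> \<alpha> ^ card \<C> * card (X + Z)"
proof -
  define f where "f Y = (\<Sum>C\<in>\<C>. real (card (Y + C))) / card Y" for Y
  define \<Y> where "\<Y> = {Y. Y \<subseteq> H \<and> Y \<noteq> {}}"
  define X where "X = arg_min_on f \<Y>"
  have "\<Y> \<noteq> {}" using assms(1) by (auto simp: \<Y>_def)
  then have "X \<in> \<Y>" unfolding X_def by (intro arg_min_if_finite(1) finite)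
  then have X: "X \<subseteq> H" "X \<noteq> {}" by (simp_all add: \<Y>_def)
  have min: "f X \<le> f Y" if "Y \<subseteq> H" "Y \<noteq> {}" for Y
    unfolding X_def using \<open>\<Y> \<noteq> {}\<close> that by (intro arg_min_least) (auto simp: \<Y>_def)
  have Xpos: "real (card X) > 0" using X by (auto simp: card_gt_0_iff)
  have Z: "(\<Sum>C\<in>\<C>. real (card (X + C + Z))) \<le> f X * card (X + Z)" for Z
  proof (rule Petridis_sum)
    fix Y assume Y: "Y \<subseteq> X" "Y \<noteq> {}"
    then have "f X \<le> f Y" using X by (intro min) auto
    moreover have "real (card Y) > 0" using Y by (auto simp: card_gt_0_iff)
    ultimately show "f X * card Y \<le> (\<Sum>C\<in>\<C>. real (card (Y + C)))"
      unfolding f_def[of Y] by (simp add: field_simps)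
  qed (use Xpos in \<open>simp add: f_def\<close>)
  have "f X \<le> f H" using assms(1) by (intro min) auto
  also have "\<dots> \<le> card \<C> * \<alpha>"
  proof -
    have "(\<Sum>C\<in>\<C>. real (card (H + C))) \<le> (\<Sum>C\<in>\<C>. \<alpha> * card H)" by (intro sum_mono small)
    moreover have "real (card H) > 0" using assms(1) by (auto simp: card_gt_0_iff)
    ultimately show ?thesis by (simp add: f_def field_simps)
  qed
  finally have fX: "f X \<le> card \<C> * \<alpha>" .
  have "real (card (X + C + Z)) \<le> \<alpha> ^ card \<C> * card (X + Z)" if C: "C \<in> \<C>" for C Z
  proof -
    have "real (card \<C>) \<ge> 1" using C finite[of \<C>] by (simp add: Suc_le_eq card_gt_0_iff) blast
    have "card H > 0" using assms(1) by (auto simp: card_gt_0_iff)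
    moreover have "real (card H) \<le> \<alpha> * card H"
      using card_le_card_plus[OF ne[OF C], of H] small[OF C] by linarith
    ultimately have \<alpha>: "\<alpha> \<ge> 1" by simp
    have "(\<Sum>D\<in>\<C> - {C}. real (card (X + Z))) \<le> (\<Sum>D\<in>\<C> - {C}. real (card (X + D + Z)))"
    proof (intro sum_mono of_nat_mono)
      fix D assume "D \<in> \<C> - {C}"
      then show "card (X + Z) \<le> card (X + D + Z)"
        using card_le_card_plus[OF ne, of D "X + Z"] by (simp add: ac_simps)
    qed
    moreover have "(\<Sum>D\<in>\<C>. real (card (X + D + Z))) =
        real (card (X + C + Z)) + (\<Sum>D\<in>\<C> - {C}. real (card (X + D + Z)))"
      using C by (intro sum.remove) auto
    moreover have "(\<Sum>D\<in>\<C> - {C}. real (card (X + Z))) = (real (card \<C>) - 1) * card (X + Z)"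
      using C \<open>real (card \<C>) \<ge> 1\<close> by (simp add: of_nat_diff)
    ultimately have "real (card (X + C + Z)) \<le> f X * card (X + Z) - (real (card \<C>) - 1) * card (X + Z)"
      using Z[of Z] by linarith
    also have "\<dots> \<le> (1 + card \<C> * (\<alpha> - 1)) * card (X + Z)"
      using mult_right_mono[OF fX, of "real (card (X + Z))"] by (simp add: algebra_simps)
    \<comment> \<open>Bernoulli's inequality. The factor is 1 at \<open>\<alpha> = 1\<close>, so the
      size of the family alone costs nothing.\<close>
    also have "\<dots> \<le> \<alpha> ^ card \<C> * card (X + Z)"
      using Bernoulli_inequality[of "\<alpha> - 1" "card \<C>"] \<alpha> by (intro mult_right_mono) auto
    finally show ?thesis .
  qed
  then show ?thesis using X that by auto
qed

text \<open>One \<open>X\<close> serves every summand, so the summands can be peeled off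
  \<open>X + sum_list Cs\<close> one by one, each at the cost \<open>\<alpha> ^ N\<close>. At most
  \<open>N\<close> such steps give the exponent \<open>N * N\<close>.\<close>

lemma Plunnecke_sum_list:
  fixes H :: "'a::{ab_group_add,finite} set" and \<alpha> :: real
  assumes "H \<noteq> {}" "\<alpha> \<ge> 1" "length Cs \<le> N" and ne: "\<And>C. C \<in> set Cs \<Longrightarrow> C \<noteq> {}"
    and small: "\<And>C. C \<in> set Cs \<Longrightarrow> real (card (H + C)) \<le> \<alpha> * card H"
  shows "real (card (sum_list Cs)) \<le> \<alpha> ^ (N * N) * card H"
proof -
  obtain X where X: "X \<subseteq> H" "X \<noteq> {}"
    "\<And>C Z. C \<in> set Cs \<Longrightarrow> real (card (X + C + Z)) \<le> \<alpha> ^ card (set Cs) * card (X + Z)"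
    using simultaneous_Plunnecke[of H "set Cs" \<alpha>] assms by blast
  have le: "\<alpha> ^ card (set Cs) \<le> \<alpha> ^ N"
    using assms(2,3) card_length[of Cs] by (intro power_increasing) auto
  have "real (card (X + sum_list Ds)) \<le> (\<alpha> ^ N) ^ length Ds * card X" if "set Ds \<subseteq> set Cs" for Ds
    using that
  proof (induction Ds)
    case Nil
    then show ?case by (simp add: set_zero)
  next
    case (Cons C Ds)
    have "real (card (X + sum_list (C # Ds))) = card (X + C + sum_list Ds)" by (simp add: add.assoc)
    also have "\<dots> \<le> \<alpha> ^ card (set Cs) * card (X + sum_list Ds)" using Cons.prems by (intro X(3)) auto
    also have "\<dots> \<le> \<alpha> ^ N * ((\<alpha> ^ N) ^ length Ds * card X)"
      using Cons le assms(2) by (intro mult_mono) auto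
    finally show ?case by (simp add: mult.assoc)
  qed
  from this[of Cs] have "real (card (X + sum_list Cs)) \<le> (\<alpha> ^ N) ^ length Cs * card X" by simp
  also have "\<dots> \<le> (\<alpha> ^ N) ^ N * card H"
    using assms X(1) by (intro mult_mono power_increasing) (auto intro: card_mono)
  finally have "real (card (X + sum_list Cs)) \<le> \<alpha> ^ (N * N) * card H" by (simp add: power_mult)
  moreover have "card (sum_list Cs) \<le> card (X + sum_list Cs)"
    using card_le_card_plus[OF X(2), of "sum_list Cs"] by (simp add: add.commute)
  ultimately show ?thesis by linarith
qed

subsection \<open>Averaging\<close>

text \<open>Convexity of the power function through its tangent at \<open>c\<close>: Bernoulli's
  inequality bounds \<open>f i ^ r\<close> below by a linear function of \<open>f i\<close>, and the
  mean of \<open>f\<close> is at least \<open>c\<close>.\<close>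

lemma power_mean_bound:
  fixes f :: "'i \<Rightarrow> real" and c :: real
  assumes "\<And>i. i \<in> I \<Longrightarrow> f i \<ge> 0" "c \<ge> 0" "c * card I \<le> (\<Sum>i\<in>I. f i)"
  shows "c ^ r * card I \<le> (\<Sum>i\<in>I. f i ^ r)"
proof (cases "c = 0 \<or> r = 0")
  case True
  then show ?thesis using assms(1) by (cases r) (auto intro!: sum_nonneg)
next
  case False
  then have c: "c > 0" using assms(2) by simp
  have "c ^ r * (1 + r * (f i / c - 1)) \<le> f i ^ r" if "i \<in> I" for i
  proof -
    have "1 + r * (f i / c - 1) \<le> (f i / c) ^ r"
      using Bernoulli_inequality[of "f i / c - 1" r] assms(1)[OF that] c by simp
    then have "c ^ r * (1 + r * (f i / c - 1)) \<le> c ^ r * (f i / c) ^ r"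
      using c by (intro mult_left_mono) auto
    then show ?thesis using c by (simp add: power_divide)
  qed
  then have "(\<Sum>i\<in>I. c ^ r * (1 + r * (f i / c - 1))) \<le> (\<Sum>i\<in>I. f i ^ r)" by (rule sum_mono)
  moreover have "(\<Sum>i\<in>I. c ^ r * (1 + r * (f i / c - 1))) =
      c ^ r * (card I + r * ((\<Sum>i\<in>I. f i) / c - card I))"
    by (simp add: sum.distrib sum_subtractf sum_divide_distrib flip: sum_distrib_left)
  moreover have "(\<Sum>i\<in>I. f i) / c - card I \<ge> 0" using assms(3) c by (simp add: field_simps)
  then have "c ^ r * card I \<le> c ^ r * (card I + r * ((\<Sum>i\<in>I. f i) / c - card I))"
    using c by (intro mult_left_mono) auto
  ultimately show ?thesis by linarith
qed

text \<open>Cauchy-Schwarz on the fibres of \<open>f\<close>: the colliding pairs are counted by the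
  sum of the squared fibre sizes.\<close>

lemma card_collisions:
  assumes "finite S"
  shows "(real (card S))\<^sup>2 \<le> card (f ` S) * card {(x, y). x \<in> S \<and> y \<in> S \<and> f x = f y}"
proof (cases "S = {}")
  case False
  define c where "c = real (card S) / card (f ` S)"
  have pos: "real (card (f ` S)) > 0" using assms False by (simp add: card_gt_0_iff)
  define F where "F z = {x \<in> S. f x = z}" for z
  have fin: "finite (F z)" for z using assms by (simp add: F_def)
  have "card S = (\<Sum>z\<in>f ` S. card (F z))"
    using assms by (subst card_UN_disjoint[symmetric]) (auto simp: F_def intro!: arg_cong[where f = card])
  then have "c * card (f ` S) \<le> (\<Sum>z\<in>f ` S. real (card (F z)))" using pos by (simp add: c_def)
  then have "c ^ 2 * card (f ` S) \<le> (\<Sum>z\<in>f ` S. real (card (F z)) ^ 2)"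
    by (intro power_mean_bound) (auto simp: c_def)
  also have "\<dots> = real (\<Sum>z\<in>f ` S. card (F z \<times> F z))"
    by (simp add: card_cartesian_product power2_eq_square)
  also have "(\<Sum>z\<in>f ` S. card (F z \<times> F z)) = card (\<Union>z\<in>f ` S. F z \<times> F z)"
    using assms fin by (intro card_UN_disjoint[symmetric]) (auto simp: F_def)
  also have "(\<Union>z\<in>f ` S. F z \<times> F z) = {(x, y). x \<in> S \<and> y \<in> S \<and> f x = f y}"
    by (auto simp: F_def)
  finally show ?thesis using pos by (simp add: c_def field_simps power2_eq_square)
qed simp

text \<open>Draw \<open>r\<close> points \<open>ws\<close> of \<open>\<Omega>\<close> with
  repetition and let \<open>M ws\<close> be their common neighbourhood in \<open>B\<close>. By
  convexity it has on average at least \<open>\<delta> ^ r * card B\<close> elements, while an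
  \<open>N\<close>-tuple with few common neighbours (the set \<open>D\<close>) falls inside it with
  probability at most \<open>\<zeta> ^ r\<close>. Some choice thus leaves few bad tuples, which are
  then destroyed by deletion.\<close>

lemma dependent_random_choice:
  fixes G :: "'w \<Rightarrow> 'b \<Rightarrow> bool" and \<delta> \<zeta> :: real
  assumes fin: "finite \<Omega>" "finite B" and "\<Omega> \<noteq> {}" "N > 0" "\<delta> \<ge> 0" "\<zeta> \<ge> 0"
    and dens: "\<delta> * card \<Omega> * card B \<le> card {(w, b). w \<in> \<Omega> \<and> b \<in> B \<and> G w b}"
    and small: "\<zeta> ^ r * card B ^ N \<le> \<delta> ^ r * card B / 2"
  obtains B' where "B' \<subseteq> B" "\<delta> ^ r * card B / 2 \<le> card B'"
    "\<And>bs. set bs \<subseteq> B' \<Longrightarrow> length bs = N \<Longrightarrow> \<zeta> * card \<Omega> \<le> card {w \<in> \<Omega>. \<forall>b\<in>set bs. G w b}"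
proof -
  define W where "W = {ws. set ws \<subseteq> \<Omega> \<and> length ws = r}"
  define com where "com S = {w \<in> \<Omega>. \<forall>b\<in>S. G w b}" for S
  define D where "D = {bs. set bs \<subseteq> B \<and> length bs = N \<and> real (card (com (set bs))) < \<zeta> * card \<Omega>}"
  define M where "M ws = {b \<in> B. \<forall>w\<in>set ws. G w b}" for ws
  have finW: "finite W" and cardW: "card W = card \<Omega> ^ r"
    using fin by (simp_all add: W_def finite_lists_length_eq card_lists_length_eq)
  have D: "D \<subseteq> {bs. set bs \<subseteq> B \<and> length bs = N}" by (auto simp: D_def)
  then have finD: "finite D" using fin finite_lists_length_eq finite_subset by blast
  have cardD: "card D \<le> card B ^ N"
    using card_mono[OF _ D] fin by (simp add: finite_lists_length_eq card_lists_length_eq)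
  have lists: "card {ws \<in> W. \<forall>w\<in>set ws. \<forall>b\<in>S. G w b} = card (com S) ^ r" for S
  proof -
    have "{ws \<in> W. \<forall>w\<in>set ws. \<forall>b\<in>S. G w b} = {ws. set ws \<subseteq> com S \<and> length ws = r}"
      by (auto simp: W_def com_def)
    then show ?thesis using fin by (simp add: com_def card_lists_length_eq)
  qed
  have "(\<Sum>ws\<in>W. card (M ws)) = (\<Sum>b\<in>B. card {ws \<in> W. \<forall>w\<in>set ws. G w b})"
    unfolding M_def using finW fin by (intro sum_multicount_gen) auto
  also have "\<dots> = (\<Sum>b\<in>B. card (com {b}) ^ r)"
    using lists[of "{_}"] by simp
  finally have sumM: "(\<Sum>ws\<in>W. real (card (M ws))) = (\<Sum>b\<in>B. real (card (com {b})) ^ r)"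
    by (simp flip: of_nat_sum of_nat_power)
  have "card {(w, b). w \<in> \<Omega> \<and> b \<in> B \<and> G w b} = (\<Sum>b\<in>B. card (com {b}))"
  proof -
    have "{(w, b). w \<in> \<Omega> \<and> b \<in> B \<and> G w b} = (\<lambda>(b, w). (w, b)) ` (SIGMA b:B. com {b})"
      by (auto simp: com_def image_iff)
    moreover have "inj_on (\<lambda>(b, w). (w, b)) (SIGMA b:B. com {b})" by (auto simp: inj_on_def)
    ultimately show ?thesis using fin by (simp add: card_image com_def)
  qed
  then have "\<delta> * card \<Omega> * card B \<le> (\<Sum>b\<in>B. real (card (com {b})))" using dens by simp
  then have lowM: "(\<delta> * card \<Omega>) ^ r * card B \<le> (\<Sum>ws\<in>W. real (card (M ws)))"
    unfolding sumM using assms(5) by (intro power_mean_bound) auto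
  have "(\<Sum>ws\<in>W. card {bs \<in> D. set bs \<subseteq> M ws}) = (\<Sum>bs\<in>D. card {ws \<in> W. set bs \<subseteq> M ws})"
    using finW finD by (intro sum_multicount_gen) auto
  also have "\<dots> = (\<Sum>bs\<in>D. card (com (set bs)) ^ r)"
  proof (intro sum.cong refl)
    fix bs assume "bs \<in> D"
    then have "{ws \<in> W. set bs \<subseteq> M ws} = {ws \<in> W. \<forall>w\<in>set ws. \<forall>b\<in>set bs. G w b}"
      by (auto simp: M_def D_def)
    then show "card {ws \<in> W. set bs \<subseteq> M ws} = card (com (set bs)) ^ r" using lists by simp
  qed
  finally have "(\<Sum>ws\<in>W. real (card {bs \<in> D. set bs \<subseteq> M ws})) = (\<Sum>bs\<in>D. real (card (com (set bs))) ^ r)"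
    by (simp flip: of_nat_sum of_nat_power)
  also have "\<dots> \<le> (\<Sum>bs\<in>D. (\<zeta> * card \<Omega>) ^ r)"
    by (intro sum_mono power_mono) (auto simp: D_def)
  also have "\<dots> \<le> card B ^ N * (\<zeta> * card \<Omega>) ^ r"
    using cardD assms(6) by (simp add: mult_right_mono flip: of_nat_power)
  finally have upD: "(\<Sum>ws\<in>W. real (card {bs \<in> D. set bs \<subseteq> M ws})) \<le> card \<Omega> ^ r * (\<zeta> ^ r * card B ^ N)"
    by (simp add: power_mult_distrib mult_ac)
  have "\<exists>ws\<in>W. \<delta> ^ r * card B / 2 \<le> real (card (M ws)) - card {bs \<in> D. set bs \<subseteq> M ws}"
  proof (rule ccontr)
    assume neg: "\<not> ?thesis"
    have "W \<noteq> {}" using cardW assms(3) fin by (auto simp: card_eq_0_iff)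
    then have "(\<Sum>ws\<in>W. real (card (M ws)) - card {bs \<in> D. set bs \<subseteq> M ws}) < (\<Sum>ws\<in>W. \<delta> ^ r * card B / 2)"
      using neg finW by (intro sum_strict_mono) auto
    also have "\<dots> = card \<Omega> ^ r * (\<delta> ^ r * card B / 2)" by (simp add: cardW)
    finally have "(\<Sum>ws\<in>W. real (card (M ws))) - (\<Sum>ws\<in>W. real (card {bs \<in> D. set bs \<subseteq> M ws}))
        < card \<Omega> ^ r * (\<delta> ^ r * card B / 2)" by (simp add: sum_subtractf)
    moreover have "card \<Omega> ^ r * (\<zeta> ^ r * card B ^ N) \<le> card \<Omega> ^ r * (\<delta> ^ r * card B / 2)"
      using small by (intro mult_left_mono) auto
    ultimately show False using lowM upD by (simp add: power_mult_distrib field_simps)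
  qed
  then obtain ws where ws: "ws \<in> W" "\<delta> ^ r * card B / 2 \<le> real (card (M ws)) - card {bs \<in> D. set bs \<subseteq> M ws}"
    by blast
  \<comment> \<open>Removing the first entry of each bad tuple leaves none inside \<open>B'\<close>;
    \<open>N > 0\<close> guarantees that this entry exists.\<close>
  define B' where "B' = M ws - hd ` {bs \<in> D. set bs \<subseteq> M ws}"
  have "card (M ws) - card (hd ` {bs \<in> D. set bs \<subseteq> M ws}) \<le> card B'"
    unfolding B'_def using finD by (intro diff_card_le_card_Diff) auto
  moreover have "card (hd ` {bs \<in> D. set bs \<subseteq> M ws}) \<le> card {bs \<in> D. set bs \<subseteq> M ws}"
    using finD by (intro card_image_le) auto
  ultimately have "\<delta> ^ r * card B / 2 \<le> card B'" using ws(2) by linarith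
  moreover have "B' \<subseteq> B" by (auto simp: B'_def M_def)
  moreover have "\<zeta> * card \<Omega> \<le> card {w \<in> \<Omega>. \<forall>b\<in>set bs. G w b}"
    if bs: "set bs \<subseteq> B'" "length bs = N" for bs
  proof (rule ccontr)
    assume "\<not> ?thesis"
    then have "bs \<in> {bs \<in> D. set bs \<subseteq> M ws}"
      using bs \<open>B' \<subseteq> B\<close> by (auto simp: D_def com_def B'_def)
    then have "hd bs \<notin> B'" by (auto simp: B'_def)
    moreover have "hd bs \<in> set bs" using bs(2) assms(4) by (intro hd_in_set) auto
    ultimately show False using bs(1) by auto
  qed
  ultimately show ?thesis using that by blast
qed

text \<open>
  Markov's inequality without a constant factor: such a factor would later be raised to a high power,
  which is not affordable when \<open>p powr (s\<^sup>2)\<close> is close to 1.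
\<close>

lemma many_large_values:
  fixes f :: "'i \<Rightarrow> real" and p s :: real
  assumes "finite X" "\<And>x. x \<in> X \<Longrightarrow> f x \<le> 1" "p \<ge> exp 1" "0 < s" "s \<le> 1"
    and avg: "p powr - (s\<^sup>2) * card X \<le> (\<Sum>x\<in>X. f x)"
  shows "p powr (- 2 * s) * card X \<le> card {x \<in> X. f x \<ge> p powr (- 2 * s)}"
proof -
  define \<kappa> where "\<kappa> = s\<^sup>2 * ln p"
  define \<theta> where "\<theta> = p powr (- 2 * s)"
  \<comment> \<open>The inequality \<open>key\<close> below amounts to
    \<open>z\<^sup>2 \<le> (1 - \<theta>)\<^sup>2\<close>, so \<open>\<theta> \<le> 1 - z\<close>
    suffices; and \<open>exp (- \<kappa>)\<close> factors as
    \<open>(1 - z) * (1 + z)\<close>.\<close>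
  define z where "z = sqrt (1 - exp (- \<kappa>))"
  have p: "p > 0" using assms(3) exp_gt_zero[of 1] by linarith
  have lnp: "ln p \<ge> 1" using assms(3) p by (simp add: ln_ge_iff)
  have \<kappa>: "\<kappa> > 0" using assms lnp by (simp add: \<kappa>_def)
  have \<theta>: "\<theta> = exp (- 2 * s * ln p)" using p by (simp add: \<theta>_def powr_def)
  have "\<theta> < 1" "\<theta> > 0" using assms lnp by (simp_all add: \<theta>)
  have z0: "0 \<le> z" "z < 1" "z\<^sup>2 = 1 - exp (- \<kappa>)" using \<kappa> by (auto simp: z_def)
  have "z \<le> sqrt \<kappa>" unfolding z_def using exp_ge_add_one_self[of "-\<kappa>"] by simp
  also have "sqrt \<kappa> = s * sqrt (ln p)" using assms by (simp add: \<kappa>_def real_sqrt_mult)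
  also have "\<dots> \<le> s * ln p"
    using lnp assms by (intro mult_left_mono) (auto intro!: real_le_lsqrt simp: power2_eq_square)
  finally have "z \<le> s * ln p" .
  moreover have "\<kappa> \<le> s * ln p"
    using assms lnp by (simp add: \<kappa>_def power2_eq_square mult_left_le)
  \<comment> \<open>The exponent \<open>2 * s\<close> consists of one \<open>s * ln p\<close> for
    \<open>\<kappa>\<close> and one for \<open>z \<le> sqrt \<kappa>\<close>.\<close>
  ultimately have "\<theta> \<le> exp (- \<kappa>) * exp (- z)" by (simp add: \<theta> flip: exp_add)
  also have "\<dots> \<le> exp (- \<kappa>) / (1 + z)"
    using exp_ge_add_one_self[of z] z0 by (simp add: exp_minus divide_simps)
  also have "\<dots> = 1 - z"
  proof -
    have "exp (- \<kappa>) = (1 - z) * (1 + z)" using z0(3) by (simp add: algebra_simps power2_eq_square)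
    then show ?thesis using z0 by simp
  qed
  finally have "z \<le> 1 - \<theta>" by simp
  then have "z\<^sup>2 \<le> (1 - \<theta>)\<^sup>2" using z0 by (intro power_mono) auto
  then have key: "\<theta> * (1 - \<theta>) \<le> exp (- \<kappa>) - \<theta>" using z0 by (simp add: power2_eq_square algebra_simps)
  define Y where "Y = {x \<in> X. f x \<ge> \<theta>}"
  have Y: "Y \<subseteq> X" by (auto simp: Y_def)
  have "exp (- \<kappa>) * card X \<le> (\<Sum>x\<in>X. f x)" using avg p by (simp add: powr_def \<kappa>_def)
  also have "\<dots> = (\<Sum>x\<in>Y. f x) + (\<Sum>x\<in>X - Y. f x)"
    using sum.subset_diff[OF Y assms(1), of f] by simp
  also have "\<dots> \<le> (\<Sum>x\<in>Y. 1) + (\<Sum>x\<in>X - Y. \<theta>)"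
    using assms(2) by (intro add_mono sum_mono) (auto simp: Y_def)
  also have "\<dots> = card Y + \<theta> * (real (card X) - card Y)"
    using card_mono[OF assms(1) Y] finite_subset[OF Y assms(1)]
    by (simp add: card_Diff_subset[OF _ Y] of_nat_diff)
  finally have "(exp (- \<kappa>) - \<theta>) * card X \<le> (1 - \<theta>) * card Y" by (simp add: algebra_simps)
  moreover have "\<theta> * (1 - \<theta>) * card X \<le> (exp (- \<kappa>) - \<theta>) * card X"
    using key by (intro mult_right_mono) auto
  ultimately have "(1 - \<theta>) * (\<theta> * card X) \<le> (1 - \<theta>) * card Y" by (simp add: mult_ac)
  then have "\<theta> * card X \<le> card Y" using \<open>\<theta> < 1\<close> by simp
  then show ?thesis by (simp add: \<theta>_def Y_def)
qed

lemma greedy_growth: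
  fixes K :: real and P :: "nat \<Rightarrow> 'a::finite set \<Rightarrow> bool"
  assumes "P 0 X0" "X0 \<noteq> {}" "K > 0" "real CARD('a) \<le> K ^ n" "n > 0"
    and step: "\<And>j X. P j X \<Longrightarrow> X \<noteq> {} \<Longrightarrow> \<not> S X \<Longrightarrow> \<exists>Y. P (Suc j) Y \<and> K * card X < card Y"
  obtains j X where "j < n" "P j X" "S X" "X \<noteq> {}"
proof (rule ccontr)
  assume "\<not> thesis"
  with that have neg: "\<And>j X. j < n \<Longrightarrow> P j X \<Longrightarrow> X \<noteq> {} \<Longrightarrow> \<not> S X" by blast
  \<comment> \<open>While \<open>S\<close> fails, each step gains more than a factor
    \<open>K\<close>. The strict bound starts at \<open>j = 1\<close>, since \<open>X0\<close> may
    be a singleton; at \<open>j = n\<close> it exceeds the size of the whole type.\<close>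
  have "\<exists>X. P j X \<and> X \<noteq> {} \<and> K ^ j \<le> card X \<and> (j > 0 \<longrightarrow> K ^ j < card X)" if "j \<le> n" for j
    using that
  proof (induction j)
    case 0
    have "card X0 > 0" using assms(2) by (simp add: card_gt_0_iff)
    then show ?case using assms(1,2) by (intro exI[of _ X0]) auto
  next
    case (Suc j)
    then obtain X where X: "P j X" "X \<noteq> {}" "K ^ j \<le> card X" by auto
    then have "\<not> S X" using neg[of j X] X Suc.prems by simp
    then obtain Y where Y: "P (Suc j) Y" "K * card X < card Y" using step X by blast
    have "K ^ Suc j \<le> K * card X" using X assms(3) by simp
    with Y have "K ^ Suc j < card Y" by linarith
    moreover have "Y \<noteq> {}"
    proof
      assume "Y = {}"
      then have "K * card X < 0" using Y(2) by simp
      then show False using mult_nonneg_nonneg[of K "real (card X)"] assms(3) by linarith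
    qed
    ultimately show ?case using Y by (intro exI[of _ Y]) auto
  qed
  from this[OF order_refl] obtain X where "P n X" "K ^ n < card X" using assms(5) by blast
  moreover have "card X \<le> CARD('a)" by (intro card_mono) auto
  ultimately show False using assms(4) by linarith
qed

subsection \<open>The e-transform\<close>

lemma elt_set_times_image: "a *o X = (*) a ` X"
  by (auto simp: elt_set_times_def)

lemma card_dilate:
  fixes a :: "'a::field"
  assumes "a \<noteq> 0"
  shows "card (a *o X) = card X"
  using assms by (simp add: elt_set_times_image card_image inj_on_def)

lemma shift_closed_imp_UNIV:
  fixes S :: "'p::prime_card mod_ring set"
  assumes "x \<in> S" "d \<noteq> 0" and closed: "\<And>y. y \<in> S \<Longrightarrow> y + d \<in> S"
  shows "S = UNIV"
proof -
  have shift: "x + of_nat j * d \<in> S" for j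
  proof (induction j)
    case (Suc j)
    have "x + of_nat (Suc j) * d = x + of_nat j * d + d" by (simp add: algebra_simps)
    then show ?case using closed[OF Suc] by metis
  qed (simp add: assms)
  have "y \<in> S" for y
  proof -
    obtain j where "(y - x) / d = of_nat j" using surj_of_nat_mod_ring by blast
    then have "y = x + of_nat j * d" using assms(2) by (simp add: field_simps)
    then show ?thesis using shift by metis
  qed
  then show ?thesis by auto
qed

text \<open>Second moment over all \<open>x\<close> in the field. Two distinct pairs
  \<open>(u, t)\<close> collide under \<open>u + x * t\<close> for at most one \<open>x\<close>, so
  there are at most \<open>s * (s + CARD('a))\<close> collisions in total. If every sum were small,
  Cauchy-Schwarz would force more.\<close>

lemma exists_large_dilate_sum:
  fixes T U :: "'a::{field,finite} set"
  assumes "T \<noteq> {}" "U \<noteq> {}"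
  defines "s \<equiv> real (card U) * card T"
  shows "\<exists>x. s * CARD('a) / (s + CARD('a)) \<le> card (U + x *o T)"
proof (rule ccontr)
  assume "\<not> ?thesis"
  then have neg: "card (U + x *o T) < s * CARD('a) / (s + CARD('a))" for x by (simp add: not_le)
  define S where "S = U \<times> T"
  define f where "f x = (\<lambda>(u, t). u + x * t)" for x :: 'a
  define E where "E x = {pr \<in> S \<times> S. f x (fst pr) = f x (snd pr)}" for x
  have s: "s > 0" "real (card S) = s"
    using assms by (simp_all add: s_def S_def card_cartesian_product card_gt_0_iff)
  have img: "f x ` S = U + x *o T" for x
    by (auto simp: f_def S_def set_plus_def elt_set_times_def image_iff) 
  have strict: "s\<^sup>2 < s * CARD('a) / (s + CARD('a)) * card (E x)" for x
  proof -
    have "E x = {(v, w). v \<in> S \<and> w \<in> S \<and> f x v = f x w}" by (auto simp: E_def)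
    then have le: "s\<^sup>2 \<le> card (U + x *o T) * card (E x)"
      using card_collisions[of S "f x"] by (simp add: s img)
    then have "card (E x) > 0" using s by (intro gr0I) auto
    then have "real (card (U + x *o T)) * card (E x) < s * CARD('a) / (s + CARD('a)) * card (E x)"
      using neg by (intro mult_strict_right_mono) auto
    with le show ?thesis by simp
  qed
  have "(\<Sum>x\<in>(UNIV::'a set). card (E x)) =
      (\<Sum>pr\<in>S \<times> S. card {x \<in> UNIV. f x (fst pr) = f x (snd pr)})"
    unfolding E_def by (intro sum_multicount_gen) auto
  also have "\<dots> \<le> (\<Sum>pr\<in>S \<times> S. 1 + (if fst pr = snd pr then CARD('a) else 0))"
  proof (intro sum_mono)
    fix pr :: "('a \<times> 'a) \<times> ('a \<times> 'a)"
    obtain u t u' t' where pr: "pr = ((u, t), (u', t'))" by (metis prod.collapse)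
    show "card {x \<in> UNIV. f x (fst pr) = f x (snd pr)} \<le> 1 + (if fst pr = snd pr then CARD('a) else 0)"
    proof (cases "fst pr = snd pr")
      case False
      have "x = y" if "u + x * t = u' + x * t'" "u + y * t = u' + y * t'" for x y
      proof -
        have "(x - y) * (t - t') = (u + x * t) - (u' + x * t') - ((u + y * t) - (u' + y * t'))"
          by (simp add: algebra_simps)
        then have "(x - y) * (t - t') = 0" using that by simp
        moreover have "t \<noteq> t'" using False that(1) by (auto simp: pr)
        ultimately show ?thesis by simp
      qed
      then have "card {x \<in> UNIV. f x (fst pr) = f x (snd pr)} \<le> Suc 0"
        by (auto simp: pr f_def card_le_Suc0_iff_eq)
      then show ?thesis by simp
    qed (simp add: card_mono)
  qed
  also have "\<dots> = card S * card S + CARD('a) * card S"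
  proof -
    have "(\<Sum>pr\<in>S \<times> S. if fst pr = snd pr then CARD('a) else 0) = card {pr \<in> S \<times> S. fst pr = snd pr} * CARD('a)"
      by (subst sum.inter_filter[symmetric]) auto
    also have "{pr \<in> S \<times> S. fst pr = snd pr} = (\<lambda>v. (v, v)) ` S" by auto
    also have "card \<dots> = card S" by (intro card_image) (auto simp: inj_on_def)
    finally show ?thesis unfolding sum.distrib by (simp add: card_cartesian_product)
  qed
  finally have "real (\<Sum>x\<in>(UNIV::'a set). card (E x)) \<le> real (card S * card S + CARD('a) * card S)"
    by (rule of_nat_mono)
  then have sumE: "(\<Sum>x\<in>(UNIV::'a set). real (card (E x))) \<le> s * (s + CARD('a))"
    by (simp add: s(2) algebra_simps)
  have "CARD('a) * s\<^sup>2 = (\<Sum>x\<in>(UNIV::'a set). s\<^sup>2)" by simp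
  also have "\<dots> < (\<Sum>x\<in>(UNIV::'a set). s * CARD('a) / (s + CARD('a)) * card (E x))"
    using strict by (intro sum_strict_mono) auto
  also have "\<dots> = s * CARD('a) / (s + CARD('a)) * (\<Sum>x\<in>(UNIV::'a set). real (card (E x)))"
    by (simp add: sum_distrib_left)
  also have "\<dots> \<le> s * CARD('a) / (s + CARD('a)) * (s * (s + CARD('a)))"
    using s by (intro mult_left_mono sumE) auto
  also have "\<dots> = CARD('a) * s\<^sup>2" using s by (simp add: power2_eq_square add_pos_pos field_simps)
  finally show False by simp
qed

text \<open>Dichotomy for the set \<open>Q\<close> of difference quotients. If it is the whole
  field, the best \<open>x\<close> overall is admissible. Otherwise some \<open>x\<close> in
  \<open>Q\<close> has \<open>x + d\<close> outside \<open>Q\<close>, with \<open>d\<close> in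
  \<open>Q\<close> too. Then all sums in \<open>U + (x + d) *o T\<close> are distinct, which
  Plunnecke's inequality forbids if \<open>U + x *o T\<close> and \<open>U + d *o T\<close> are both
  small.\<close>

lemma large_sum_with_difference_quotient:
  fixes T U :: "'p::prime_card mod_ring set"
  assumes T: "card T \<ge> 2" and U: "card U \<ge> 2"
  obtains t t' u u' where "t \<in> T" "t' \<in> T" "t \<noteq> t'" "u \<in> U" "u' \<in> U"
    "sqrt (card T) * card U / 2 \<le> card (U + ((u - u') / (t - t')) *o T) \<or>
     CARD('p) / 2 \<le> card (U + ((u - u') / (t - t')) *o T)"
proof -
  define Q where "Q = {(u - u') / (t - t') | u u' t t'. u \<in> U \<and> u' \<in> U \<and> t \<in> T \<and> t' \<in> T \<and> t \<noteq> t'}"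
  have ne: "T \<noteq> {}" "U \<noteq> {}" using T U by auto
  have "\<exists>x\<in>Q. sqrt (card T) * card U / 2 \<le> card (U + x *o T) \<or> CARD('p) / 2 \<le> card (U + x *o T)"
  proof (cases "Q = UNIV")
    case True
    define s where "s = real (card U) * card T"
    have s: "s > 0" using T U by (simp add: s_def)
    obtain x where x: "s * CARD('p) / (s + CARD('p)) \<le> card (U + x *o T)"
      using exists_large_dilate_sum[OF ne] unfolding s_def by auto
    have "sqrt (card T) * card U / 2 \<le> card (U + x *o T) \<or> CARD('p) / 2 \<le> card (U + x *o T)"
    \<comment> \<open>The bound in \<open>x\<close> is at least half of the smaller of
      \<open>s\<close> and \<open>CARD('p)\<close>.\<close>
    proof (cases "s \<le> CARD('p)")
      case True
      have "sqrt (card T) * 1 \<le> sqrt (card T) * sqrt (card T)"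
        using T by (intro mult_left_mono) auto
      then have "sqrt (card T) \<le> card T" by simp
      then have "sqrt (card T) * card U \<le> s" unfolding s_def mult.commute[of "real (card U)"] by (intro mult_right_mono) auto
      then have "sqrt (card T) * card U / 2 \<le> s / 2" by simp
      also have "\<dots> \<le> s * CARD('p) / (s + CARD('p))" using s True by (simp add: field_simps add_pos_pos)
      finally show ?thesis using x by linarith
    next
      case False
      then have "CARD('p) / 2 \<le> s * CARD('p) / (s + CARD('p))" using s by (simp add: field_simps add_pos_pos)
      then show ?thesis using x by linarith
    qed
    then show ?thesis using True by auto
  next
    case False
    obtain t0 t1 where t01: "t0 \<in> T" "t1 \<in> T" "t0 \<noteq> t1"
      using T card_le_Suc0_iff_eq[of T] by fastforce
    obtain u0 u1 where u01: "u0 \<in> U" "u1 \<in> U" "u0 \<noteq> u1"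
      using U card_le_Suc0_iff_eq[of U] by fastforce
    define d where "d = (u0 - u1) / (t0 - t1)"
    have d: "d \<in> Q" "d \<noteq> 0" using t01 u01 unfolding d_def Q_def by auto
    obtain x where x: "x \<in> Q" "x + d \<notin> Q" using shift_closed_imp_UNIV[OF d] False by blast
    show ?thesis
    proof (rule ccontr)
      assume "\<not> ?thesis"
      then have neg: "card (U + y *o T) < sqrt (card T) * card U / 2" if "y \<in> Q" for y
        using that by (auto simp: not_le)
      \<comment> \<open>With the union, one application of Plunnecke handles both dilates; the
        factors 1/2 in the claim pay for it.\<close>
      define C where "C = x *o T \<union> d *o T"
      have "card (U + C) \<le> card (U + x *o T) + card (U + d *o T)"
        unfolding C_def set_plus_Un by (rule card_Un_le)
      then have UC: "card (U + C) < sqrt (card T) * card U" using neg[OF x(1)] neg[OF d(1)] by linarith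
      define \<alpha> where "\<alpha> = real (card (U + C)) / card U"
      have Upos: "real (card U) > 0" using U by simp
      have \<alpha>: "\<alpha> < sqrt (card T)" "\<alpha> \<ge> 0" using UC Upos by (auto simp: \<alpha>_def field_simps)
      have "C \<noteq> {}" using ne by (auto simp: C_def elt_set_times_def)
      moreover have "real (card (U + C)) \<le> \<alpha> * card U" using Upos by (simp add: \<alpha>_def)
      ultimately obtain X where X: "X \<subseteq> U" "X \<noteq> {}"
        and "\<And>D Z. D \<in> {C} \<Longrightarrow> real (card (X + D + Z)) \<le> \<alpha> ^ card {C} * card (X + Z)"
        using simultaneous_Plunnecke[OF ne(2), of "{C}" \<alpha>] by blast
      then have P: "real (card (X + C + Z)) \<le> \<alpha> * card (X + Z)" for Z by simp
      have "real (card (X + C + C)) \<le> \<alpha> * card (X + C)" by (rule P)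
      also have "\<dots> \<le> \<alpha> * (\<alpha> * card X)" using P[of "{0}"] \<alpha>(2) by (intro mult_left_mono) auto
      finally have "real (card (X + C + C)) \<le> \<alpha> * (\<alpha> * card X)" .
      moreover have "X + (x + d) *o T \<subseteq> X + C + C"
      proof
        fix y assume "y \<in> X + (x + d) *o T"
        then obtain v t where vt: "v \<in> X" "t \<in> T" "y = v + (x + d) * t"
          by (auto simp: elt_set_times_def elim!: set_plus_elim)
        then have "y = v + x * t + d * t" by (simp add: algebra_simps)
        moreover have "x * t \<in> C" "d * t \<in> C" using vt by (auto simp: C_def)
        ultimately show "y \<in> X + C + C" using vt(1) by blast
      qed
      moreover have "card (X + (x + d) *o T) = card X * card T"
      proof -
        \<comment> \<open>A coincidence with \<open>t \<noteq> t'\<close> would exhibit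
          \<open>x + d\<close> as a quotient of differences of \<open>X \<subseteq> U\<close> and
          \<open>T\<close>.\<close>
        have "inj_on (\<lambda>(v, t). v + (x + d) * t) (X \<times> T)"
        proof (rule inj_onI, clarsimp)
          fix v t v' t' assume *: "v \<in> X" "t \<in> T" "v' \<in> X" "t' \<in> T" "v + (x + d) * t = v' + (x + d) * t'"
          have tt: "t = t'"
          proof (rule ccontr)
            assume "t \<noteq> t'"
            have "(x + d) * (t - t') = (v + (x + d) * t) - (v' + (x + d) * t') + (v' - v)"
              by (simp add: algebra_simps)
            also have "\<dots> = v' - v" using *(5) by simp
            finally have "(x + d) * (t - t') = v' - v" .
            with \<open>t \<noteq> t'\<close> have "x + d = (v' - v) / (t - t')" by (simp add: field_simps)
            then show False using x(2) * X(1) \<open>t \<noteq> t'\<close> unfolding Q_def by blast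
          qed
          then show "v = v' \<and> t = t'" using *(5) by simp
        qed
        moreover have "(\<lambda>(v, t). v + (x + d) * t) ` (X \<times> T) = X + (x + d) *o T"
          by (auto simp: set_plus_def elt_set_times_def image_iff)
        ultimately show ?thesis by (metis card_image card_cartesian_product)
      qed
      ultimately have "card X * card T \<le> \<alpha> * (\<alpha> * card X)"
        by (metis card_mono finite of_nat_mono order_trans)
      then have "card T * real (card X) \<le> (\<alpha> * \<alpha>) * card X" by (simp add: mult_ac)
      moreover have "real (card X) > 0" using X by (simp add: card_gt_0_iff)
      ultimately have "card T \<le> \<alpha> * \<alpha>" by simp
      also have "\<alpha> * \<alpha> < sqrt (card T) * sqrt (card T)" using \<alpha> T by (intro mult_strict_mono) auto
      finally show False by simp
    qed
  qed
  then show ?thesis using that unfolding Q_def by blast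
qed

section \<open>Coverings by short sums from a family\<close>

definition covered :: "'a::comm_ring_1 set set \<Rightarrow> nat \<Rightarrow> 'a set \<Rightarrow> bool" where
  "covered \<C> n Y \<longleftrightarrow> (\<exists>Cs z. length Cs \<le> n \<and> set Cs \<subseteq> \<C> \<and> Y \<subseteq> z +o sum_list Cs)"

lemma covered_mono: "covered \<C> n Y \<Longrightarrow> Y' \<subseteq> Y \<Longrightarrow> n \<le> m \<Longrightarrow> covered \<C> m Y'"
  unfolding covered_def by (meson order_trans)

text \<open>Translates are allowed in \<open>covered\<close> because the e-transform brings in a
  constant \<open>(t - t') * z\<close>; they do not affect cardinalities.\<close>

lemma covered_translate: "covered \<C> n Y \<Longrightarrow> covered \<C> n (z +o Y)"
  unfolding covered_def by (metis set_plus_mono set_plus_rearrange2)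

lemma covered_single: "C \<in> \<C> \<Longrightarrow> covered \<C> 1 C"
  unfolding covered_def by (intro exI[of _ "[C]"] exI[of _ 0]) simp

lemma covered_plus:
  assumes "covered \<C> n Y" "covered \<C> m Z"
  shows "covered \<C> (n + m) (Y + Z)"
proof -
  obtain Cs z Ds w where "length Cs \<le> n" "set Cs \<subseteq> \<C>" "Y \<subseteq> z +o sum_list Cs"
    "length Ds \<le> m" "set Ds \<subseteq> \<C>" "Z \<subseteq> w +o sum_list Ds"
    using assms unfolding covered_def by blast
  moreover from this have "Y + Z \<subseteq> (z + w) +o (sum_list Cs + sum_list Ds)"
    by (simp add: set_plus_mono2 flip: set_plus_rearrange)
  ultimately show ?thesis unfolding covered_def
    by (intro exI[of _ "Cs @ Ds"] exI[of _ "z + w"]) auto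
qed

text \<open>Only dilates by differences are covered: the multiplier \<open>t - t'\<close> clears the
  denominator of a quotient \<open>x = (u - u') / (t - t')\<close>. Both directions are kept because
  the e-transform needs both to re-establish either.\<close>

definition bi_covered :: "'a::comm_ring_1 set set \<Rightarrow> nat \<Rightarrow> 'a set \<Rightarrow> 'a set \<Rightarrow> bool" where
  "bi_covered \<C> n T U \<longleftrightarrow>
    (\<forall>t\<in>T. \<forall>t'\<in>T. covered \<C> n ((t - t') *o U)) \<and> (\<forall>u\<in>U. \<forall>u'\<in>U. covered \<C> n ((u - u') *o T))"

lemma bi_covered_mono: "bi_covered \<C> n T U \<Longrightarrow> n \<le> m \<Longrightarrow> bi_covered \<C> m T U"
  unfolding bi_covered_def using covered_mono by blast

text \<open>For \<open>t\<close>, \<open>t'\<close> in the fibre, \<open>(t - t') * x\<close> is a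
  difference of elements of \<open>U\<close>, so its product with \<open>T\<close> is covered. In
  the other half \<open>w - w'\<close> contains \<open>x * (t - t')\<close>, and for
  \<open>r\<close> in the fibre \<open>x * r = z - (z - x * r)\<close> trades the uncontrolled
  \<open>x\<close> for a constant and an element of \<open>U\<close>.\<close>

lemma bi_covered_e_transform:
  assumes "bi_covered \<C> n T U"
  shows "bi_covered \<C> (2 * n) {t \<in> T. z - x * t \<in> U} (U + x *o T)"
  unfolding bi_covered_def
proof (intro conjI ballI)
  fix t t' assume t: "t \<in> {t \<in> T. z - x * t \<in> U}" "t' \<in> {t \<in> T. z - x * t \<in> U}"
  have "covered \<C> n ((t - t') *o U)" "covered \<C> n (((z - x * t') - (z - x * t)) *o T)"
    using t assms unfolding bi_covered_def by blast+
  then have "covered \<C> (n + n) ((t - t') *o U + ((z - x * t') - (z - x * t)) *o T)" by (rule covered_plus)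
  moreover have "(z - x * t') - (z - x * t) = (t - t') * x" by (simp add: algebra_simps)
  ultimately show "covered \<C> (2 * n) ((t - t') *o (U + x *o T))"
    by (simp add: set_times_plus_distrib2 set_times_rearrange2 mult_2)
next
  fix w w' assume "w \<in> U + x *o T" "w' \<in> U + x *o T"
  then obtain u t u' t' where ut: "u \<in> U" "t \<in> T" "u' \<in> U" "t' \<in> T" "w = u + x * t" "w' = u' + x * t'"
    by (auto simp: elt_set_times_def elim!: set_plus_elim)
  then have "covered \<C> n ((u - u') *o T)" "covered \<C> n (((t - t') * z) +o ((t' - t) *o U))"
    using assms by (auto simp: bi_covered_def intro!: covered_translate)
  then have "covered \<C> (n + n) ((u - u') *o T + (((t - t') * z) +o ((t' - t) *o U)))" by (rule covered_plus)
  moreover have "(w - w') *o {t \<in> T. z - x * t \<in> U} \<subseteq> (u - u') *o T + (((t - t') * z) +o ((t' - t) *o U))"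
  proof
    fix y assume "y \<in> (w - w') *o {t \<in> T. z - x * t \<in> U}"
    then obtain r where r: "r \<in> T" "z - x * r \<in> U" "y = (w - w') * r" by (auto simp: elt_set_times_def)
    have "y = (u - u') * r + ((t - t') * z + (t' - t) * (z - x * r))"
      using ut r(3) by (simp add: algebra_simps)
    then show "y \<in> (u - u') *o T + (((t - t') * z) +o ((t' - t) *o U))" using r by blast
  qed
  ultimately show "covered \<C> (2 * n) ((w - w') *o {t \<in> T. z - x * t \<in> U})"
    by (auto intro: covered_mono simp: mult_2)
qed

text \<open>Average over \<open>z\<close>: each \<open>t\<close> meets exactly \<open>card U\<close>
  values of \<open>z\<close>, all in \<open>U + x *o T\<close>. With the best \<open>z\<close> the
  e-transform does not lower the product of the cardinalities.\<close>

lemma large_fibre: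
  fixes T U :: "'a::{field,finite} set"
  shows "\<exists>z. card T * card U \<le> card {t \<in> T. z - x * t \<in> U} * card (U + x *o T)"
proof (cases "T = {} \<or> U = {}")
  case False
  show ?thesis
  proof (rule ccontr)
    assume "\<not> ?thesis"
    then have neg: "card {t \<in> T. z - x * t \<in> U} * card (U + x *o T) < card T * card U" for z by (simp add: not_le)
    have ne: "U + x *o T \<noteq> {}" using False by (auto simp: set_plus_def elt_set_times_def)
    have "card T * card U = (\<Sum>t\<in>T. card {z \<in> U + x *o T. z - x * t \<in> U})"
    proof -
      have "card {z \<in> U + x *o T. z - x * t \<in> U} = card U" if "t \<in> T" for t
      proof -
        have "{z \<in> U + x *o T. z - x * t \<in> U} = (x * t) +o U"
          using that by (force simp: set_plus_def elt_set_times_def elt_set_plus_def algebra_simps)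
        then show ?thesis by (simp add: card_translate)
      qed
      then show ?thesis by simp
    qed
    also have "\<dots> = (\<Sum>z\<in>U + x *o T. card {t \<in> T. z - x * t \<in> U})"
      by (intro sum_multicount_gen) auto
    finally have "card (U + x *o T) * (card T * card U) =
        (\<Sum>z\<in>U + x *o T. card {t \<in> T. z - x * t \<in> U} * card (U + x *o T))"
      by (simp flip: sum_distrib_right)
    also have "\<dots> < (\<Sum>z\<in>U + x *o T. card T * card U)" using neg ne by (intro sum_strict_mono) auto
    finally show False by simp
  qed
qed auto

text \<open>What is covered is not \<open>U\<close> but a dilate \<open>Y\<close> of it, which is
  enough for counting. The start is trivial as \<open>card A \<le> CARD('p)\<close>; each step
  halves the exponent of \<open>CARD('p)\<close> and doubles the number of summands.\<close>

lemma e_transform_iteration: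
  fixes A B :: "'p::prime_card mod_ring set"
  assumes bi: "bi_covered \<C> 2 A B" and B: "card B \<ge> 2" and a: "a \<noteq> 0" "covered \<C> 2 (a *o B)"
  shows "\<exists>T U Y. bi_covered \<C> (2 ^ Suc i) T U \<and> covered \<C> (2 ^ Suc i) Y \<and> card Y = card U \<and> card U \<ge> 2
    \<and> card A * card B \<le> card T * card U
    \<and> (real (card A * card B) \<le> 4 * CARD('p) powr (1 / 2 ^ i) * card U \<or> CARD('p) / 2 \<le> card U)"
proof (induction i)
  case 0
  have "card A \<le> CARD('p mod_ring)" by (intro card_mono) auto
  then have "real (card A) \<le> 4 * CARD('p)" by simp
  then have "real (card A) * card B \<le> real (4 * CARD('p)) * card B" by (intro mult_right_mono) auto
  then show ?case using assms by (intro exI[of _ A] exI[of _ B] exI[of _ "a *o B"]) (simp add: card_dilate)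
next
  case (Suc i)
  then obtain T U Y where IH: "bi_covered \<C> (2 ^ Suc i) T U" "covered \<C> (2 ^ Suc i) Y" "card Y = card U"
    "card U \<ge> 2" "card A * card B \<le> card T * card U"
    "real (card A * card B) \<le> 4 * CARD('p) powr (1 / 2 ^ i) * card U \<or> CARD('p) / 2 \<le> card U" by blast
  show ?case
  \<comment> \<open>The pair is kept once \<open>U\<close> is large or \<open>T\<close> has at most
    one element; in the latter case \<open>card A * card B \<le> card U\<close>.\<close>
  proof (cases "CARD('p) / 2 \<le> card U \<or> card T < 2")
    case True
    have "real (card A * card B) \<le> 4 * CARD('p) powr (1 / 2 ^ Suc i) * card U" if "card T < 2"
    proof -
      have "card T * card U \<le> 1 * card U" using that by (intro mult_right_mono) auto
      then have "real (card A * card B) \<le> 1 * real (card U)" using IH(5) by linarith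
      also have "1 * real (card U) \<le> 4 * CARD('p) powr (1 / 2 ^ Suc i) * card U"
        using ge_one_powr_ge_zero[of "real CARD('p)" "1 / 2 ^ Suc i"] by (intro mult_right_mono) auto
      finally show ?thesis .
    qed
    moreover have "bi_covered \<C> (2 ^ Suc (Suc i)) T U" using IH(1) by (rule bi_covered_mono) simp
    moreover have "covered \<C> (2 ^ Suc (Suc i)) Y" using IH(2) by (rule covered_mono) simp_all
    ultimately show ?thesis using True IH(3-5) by blast
  next
    case False
    then have T: "card T \<ge> 2" and small: "real (card A * card B) \<le> 4 * CARD('p) powr (1 / 2 ^ i) * card U"
      using IH by auto
    obtain t t' u u' where tu: "t \<in> T" "t' \<in> T" "t \<noteq> t'" "u \<in> U" "u' \<in> U"
      "sqrt (card T) * card U / 2 \<le> card (U + ((u - u') / (t - t')) *o T) \<or>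
       CARD('p) / 2 \<le> card (U + ((u - u') / (t - t')) *o T)"
      using large_sum_with_difference_quotient[OF T IH(4)] by blast
    define x where "x = (u - u') / (t - t')"
    obtain z where z: "card T * card U \<le> card {t \<in> T. z - x * t \<in> U} * card (U + x *o T)"
      using large_fibre by blast
    define U' where "U' = U + x *o T"
    define Y' where "Y' = (t - t') *o U'"
    have "bi_covered \<C> (2 ^ Suc (Suc i)) {t \<in> T. z - x * t \<in> U} U'"
      using bi_covered_e_transform[OF IH(1)] by (simp add: U'_def)
    moreover have "covered \<C> (2 ^ Suc (Suc i)) Y'"
    proof -
      have "covered \<C> (2 ^ Suc i + 2 ^ Suc i) ((t - t') *o U + (u - u') *o T)"
        using IH(1) tu by (intro covered_plus) (auto simp: bi_covered_def)
      moreover have "(t - t') * x = u - u'" using tu by (simp add: x_def)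
      ultimately show ?thesis
        by (simp add: Y'_def U'_def set_times_plus_distrib2 set_times_rearrange2 mult_2)
    qed
    moreover have "card Y' = card U'" using tu by (simp add: Y'_def card_dilate)
    moreover have "card U' \<ge> 2"
      using card_le_card_plus[of "x *o T" U] tu(1) IH(4) unfolding U'_def
      by (fastforce simp: elt_set_times_def)
    moreover have "card A * card B \<le> card {t \<in> T. z - x * t \<in> U} * card U'"
      using z IH(5) by (simp add: U'_def)
    moreover have "real (card A * card B) \<le> 4 * CARD('p) powr (1 / 2 ^ Suc i) * card U'"
      if large: "sqrt (card T) * card U / 2 \<le> card U'"
    proof -
      define D where "D = real (card A * card B)"
      define w where "w = CARD('p) powr (1 / 2 ^ Suc i)"
      have D1: "sqrt D \<le> sqrt (card T) * sqrt (card U)"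
        using IH(5) by (simp add: D_def flip: real_sqrt_mult of_nat_mult)
      have D2: "sqrt D \<le> 2 * w * sqrt (card U)"
      proof (rule real_le_lsqrt)
        have "w * w = CARD('p) powr (1 / 2 ^ i)" by (simp add: w_def flip: powr_add)
        then show "D \<le> (2 * w * sqrt (card U))\<^sup>2"
          using small by (simp add: D_def power_mult_distrib power2_eq_square[of w])
      qed (auto simp: D_def w_def)
      \<comment> \<open>One factor is bounded by the invariant on \<open>card T * card U\<close>,
        the other by the previous ratio. The square root of the old 4 and the 1/2 in
        \<open>large\<close> combine to 4 again.\<close>
      have "D = sqrt D * sqrt D" by (simp add: D_def)
      also have "\<dots> \<le> (sqrt (card T) * sqrt (card U)) * (2 * w * sqrt (card U))"
        by (intro mult_mono D1 D2) (auto simp: D_def)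
      also have "\<dots> = 4 * w * (sqrt (card T) * card U / 2)" by simp
      also have "\<dots> \<le> 4 * w * card U'" using large by (intro mult_left_mono) (auto simp: w_def)
      finally show ?thesis by (simp add: D_def w_def)
    qed
    moreover have "sqrt (card T) * card U / 2 \<le> card U' \<or> CARD('p) / 2 \<le> card U'"
      using tu(6) by (simp add: U'_def x_def)
    ultimately show ?thesis by blast
  qed
qed

subsection \<open>Saturated sums\<close>

lemma signed_sumset_cong:
  assumes "\<And>i. i \<le> k \<Longrightarrow> a i = a' i \<and> s i = s' i"
  shows "signed_sumset a s B k = signed_sumset a' s' B k"
  using assms by (induction a s B k rule: signed_sumset.induct) (auto split: sign.split)

lemma diffset_dilate: "diffset H (c *o B) = H + (- c) *o (B :: 'a::ring set)"
  unfolding diffset_def set_plus_def elt_set_times_def by (auto; force)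

definition is_signed_sum :: "'a::ring set \<Rightarrow> 'a set \<Rightarrow> nat \<Rightarrow> 'a set \<Rightarrow> bool" where
  "is_signed_sum A B k H \<longleftrightarrow> k \<ge> 1 \<and> (\<exists>a s. (\<forall>i\<in>{1..k}. a i \<in> A) \<and> signed_sumset a s B k = H)"

lemma is_signed_sum_1: "a \<in> A \<Longrightarrow> is_signed_sum A B 1 (a *o B)"
  unfolding is_signed_sum_def by (auto intro!: exI[of _ "\<lambda>_. a"])

text \<open>A negative multiplier is realised by the sign \<open>Minus\<close>; only the first term,
  which has no sign, cannot be negated in this way.\<close>

lemma is_signed_sum_Suc:
  assumes "is_signed_sum A B k H" "t \<in> A \<union> uminus ` A"
  shows "is_signed_sum A B (Suc k) (H + t *o B)"
proof -
  obtain a s where as: "\<forall>i\<in>{1..k}. a i \<in> A" "signed_sumset a s B k = H" and "k \<ge> 1"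
    using assms(1) unfolding is_signed_sum_def by blast
  then obtain l where k: "k = Suc l" by (cases k) auto
  obtain c \<sigma> where c: "c \<in> A" "t = c \<and> \<sigma> = Plus \<or> t = - c \<and> \<sigma> = Minus"
    using assms(2) by auto
  have "signed_sumset (a(Suc k := c)) (s(Suc k := \<sigma>)) B k = H"
    using signed_sumset_cong[of k "a(Suc k := c)" a "s(Suc k := \<sigma>)" s B] as(2) by simp
  then have "signed_sumset (a(Suc k := c)) (s(Suc k := \<sigma>)) B (Suc k) = H + t *o B"
    using c(2) unfolding k by (auto simp: diffset_dilate)
  moreover have "\<forall>i\<in>{1..Suc k}. (a(Suc k := c)) i \<in> A" using as(1) c(1) by auto
  ultimately show ?thesis unfolding is_signed_sum_def by (metis le_add1 plus_1_eq_Suc)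
qed

lemma is_signed_sum_sum_list:
  assumes "is_signed_sum A B k H" "set ts \<subseteq> A \<union> uminus ` A"
  shows "is_signed_sum A B (k + length ts) (H + sum_list (map (\<lambda>t. t *o B) ts))"
  using assms
proof (induction ts arbitrary: k H)
  case Nil
  then show ?case by (simp add: set_zero)
next
  case (Cons t ts)
  then have "is_signed_sum A B (Suc k) (H + t *o B)" by (intro is_signed_sum_Suc) auto
  from Cons.IH[OF this] Cons.prems(2) show ?case by (simp add: add.assoc)
qed

text \<open>A multiplier in \<open>A'\<close> is a sum of elements of \<open>A\<close> and their
  negatives, so its dilate of \<open>B\<close> need not be a term of a signed sum. This inclusion
  embeds it in several such terms.\<close>

lemma dilate_sum_list_subset:
  "sum_list ts *o B \<subseteq> sum_list (map (\<lambda>t. t *o (B :: 'a::comm_ring_1 set)) ts)"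
proof (induction ts)
  case (Cons t ts)
  have "(t + sum_list ts) * b \<in> t *o B + sum_list (map (\<lambda>t. t *o B) ts)" if "b \<in> B" for b
    using that Cons.IH by (auto simp: distrib_right)
  then show ?case by (auto simp: elt_set_times_def)
qed (auto simp: elt_set_times_def)

lemma saturated_multipliers:
  fixes A :: "'a::{field,finite} set" and K :: real
  assumes "K > 0" "real CARD('a) \<le> K ^ n" "n > 0"
  obtains A' where "A' \<noteq> {}"
    "\<And>t. t \<in> A' \<Longrightarrow> \<exists>ts. set ts \<subseteq> A \<union> uminus ` A \<and> length ts \<le> n \<and> t = sum_list ts"
    "\<And>D. D \<in> {A, uminus ` A} \<Longrightarrow> real (card (A' + D)) \<le> K * card A'"
proof -
  define P where "P j X \<longleftrightarrow> (\<forall>t\<in>X. \<exists>ts. set ts \<subseteq> A \<union> uminus ` A \<and> length ts = j \<and> t = sum_list ts)"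
    for j :: nat and X
  define S where "S X \<longleftrightarrow> (\<forall>D\<in>{A, uminus ` A}. real (card (X + D)) \<le> K * card X)" for X
  have base: "P 0 {0}" by (simp add: P_def)
  have step: "\<exists>Y. P (Suc j) Y \<and> K * card X < card Y" if P: "P j X" and "X \<noteq> {}" and neg: "\<not> S X" for j X
  proof -
    obtain D where D: "D \<in> {A, uminus ` A}" "K * card X < card (X + D)"
      using neg unfolding S_def by (meson not_le)
    have "P (Suc j) (X + D)"
      unfolding P_def
    proof
      fix y assume "y \<in> X + D"
      then obtain t d where td: "t \<in> X" "d \<in> D" "y = t + d" by (auto elim!: set_plus_elim)
      then obtain ts where ts: "set ts \<subseteq> A \<union> uminus ` A" "length ts = j" "t = sum_list ts"
        using P unfolding P_def by blast
      moreover have "d \<in> A \<union> uminus ` A" using D td by auto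
      ultimately show "\<exists>ts. set ts \<subseteq> A \<union> uminus ` A \<and> length ts = Suc j \<and> y = sum_list ts"
        using td(3) by (intro exI[of _ "d # ts"]) (simp add: add.commute)
    qed
    then show ?thesis using D(2) by blast
  qed
  obtain j X where X: "j < n" "P j X" "S X" "X \<noteq> {}"
    using greedy_growth[of P, OF base insert_not_empty assms step] by blast
  show ?thesis
  proof (rule that[OF X(4)])
    show "\<exists>ts. set ts \<subseteq> A \<union> uminus ` A \<and> length ts \<le> n \<and> t = sum_list ts" if "t \<in> X" for t
      using X(1,2) that unfolding P_def by fastforce
    show "real (card (X + D)) \<le> K * card X" if "D \<in> {A, uminus ` A}" for D
      using X(3) that unfolding S_def by blast
  qed
qed

text \<open>Greedy enlargement from one dilate of \<open>B\<close>. A step for \<open>t\<close> adds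
  all the dilates whose multipliers sum to \<open>t\<close>; this gains at least as much as
  \<open>t *o B\<close> and takes at most \<open>n\<close> terms.\<close>

lemma saturated_signed_sum:
  fixes A B M :: "'a::{field,finite} set" and K :: real
  assumes "K > 0" "real CARD('a) \<le> K ^ m" "m > 0" "A \<noteq> {}" "B \<noteq> {}"
    and M: "\<And>t. t \<in> M \<Longrightarrow> \<exists>ts. set ts \<subseteq> A \<union> uminus ` A \<and> length ts \<le> n \<and> t = sum_list ts"
  obtains k H where "k \<le> 1 + m * n" "is_signed_sum A B k H" "H \<noteq> {}"
    "\<And>t. t \<in> M \<Longrightarrow> real (card (H + t *o B)) \<le> K * card H"
proof -
  define P where "P j H \<longleftrightarrow> (\<exists>k \<le> 1 + j * n. is_signed_sum A B k H)" for j H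
  obtain a where a: "a \<in> A" using assms(4) by auto
  have "P 0 (a *o B)" using is_signed_sum_1[OF a] by (auto simp: P_def)
  moreover have "a *o B \<noteq> {}" using assms(5) by (auto simp: elt_set_times_def)
  moreover have "\<exists>Y. P (Suc j) Y \<and> K * card H < card Y"
    if P: "P j H" and neg: "\<not> (\<forall>t\<in>M. real (card (H + t *o B)) \<le> K * card H)" for j H
  proof -
    obtain t where t: "t \<in> M" "K * card H < card (H + t *o B)"
      using neg by (meson not_le)
    obtain k where k: "k \<le> 1 + j * n" "is_signed_sum A B k H" using P unfolding P_def by blast
    obtain ts where ts: "set ts \<subseteq> A \<union> uminus ` A" "length ts \<le> n" "t = sum_list ts" using M[OF t(1)] by blast
    define Y where "Y = H + sum_list (map (\<lambda>t. t *o B) ts)"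
    have "is_signed_sum A B (k + length ts) Y" unfolding Y_def using k(2) ts(1) by (rule is_signed_sum_sum_list)
    then have "P (Suc j) Y" unfolding P_def using k(1) ts(2) by (intro exI[of _ "k + length ts"]) auto
    moreover have "card (H + t *o B) \<le> card Y"
      unfolding Y_def ts(3) by (intro card_mono set_plus_mono2 dilate_sum_list_subset) auto
    ultimately show ?thesis using t(2) by force
  qed
  ultimately obtain j H where "j < m" "P j H" "\<forall>t\<in>M. real (card (H + t *o B)) \<le> K * card H" "H \<noteq> {}"
    using greedy_growth[of P "a *o B" K m "\<lambda>H. \<forall>t\<in>M. real (card (H + t *o B)) \<le> K * card H"] assms
    by blast
  moreover from this obtain k where "k \<le> 1 + j * n" "is_signed_sum A B k H" unfolding P_def by blast
  moreover have "1 + j * n \<le> 1 + m * n" using \<open>j < m\<close> by simp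
  ultimately show ?thesis using that[of k H] by (meson order_trans)
qed

text \<open>Cauchy-Schwarz for the map \<open>(h, b) \<mapsto> h + t * b\<close>, whose image is
  small: a collision \<open>h + t * b0 = h' + t * b\<close> says that
  \<open>h - t * (b - b0)\<close> is the element \<open>h'\<close> of \<open>H\<close>.\<close>

lemma dilate_energy:
  fixes H B :: "'a::{field,finite} set" and K :: real
  assumes "card (H + t *o B) \<le> K * card H" "H \<noteq> {}"
  shows "real (card H) * (card B)\<^sup>2 \<le> K * card {(h, b, b0). h \<in> H \<and> b \<in> B \<and> b0 \<in> B \<and> h - t * (b - b0) \<in> H}"
    (is "_ \<le> K * card ?Z")
proof -
  define f where "f = (\<lambda>(h, b). h + t * b)"
  define E where "E = {(v, w). v \<in> H \<times> B \<and> w \<in> H \<times> B \<and> f v = f w}"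
  have img: "f ` (H \<times> B) = H + t *o B"
    by (auto simp: f_def set_plus_def elt_set_times_def image_iff)
  have "inj_on (\<lambda>(v, w). (fst v, snd w, snd v)) E"
    by (auto simp: inj_on_def E_def f_def)
  moreover have "(\<lambda>(v, w). (fst v, snd w, snd v)) ` E \<subseteq> ?Z"
  proof
    fix y assume "y \<in> (\<lambda>(v, w). (fst v, snd w, snd v)) ` E"
    then obtain h b0 h' b where *: "h \<in> H" "b0 \<in> B" "h' \<in> H" "b \<in> B" "h + t * b0 = h' + t * b" "y = (h, b, b0)"
      by (auto simp: E_def f_def)
    have "h - t * (b - b0) = (h + t * b0) - t * b" by (simp add: algebra_simps)
    also have "\<dots> = h'" using *(5) by simp
    finally show "y \<in> ?Z" using * by simp
  qed
  ultimately have "card E \<le> card ?Z" by (intro card_inj_on_le[of _ E]) auto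
  have "(real (card (H \<times> B)))\<^sup>2 \<le> card (H + t *o B) * card E"
    using card_collisions[of "H \<times> B" f] by (simp add: img E_def)
  also have "\<dots> \<le> (K * card H) * card ?Z"
    using assms(1) \<open>card E \<le> card ?Z\<close> by (simp add: mult_mono')
  finally have "real (card H) * (real (card H) * (card B)\<^sup>2) \<le> real (card H) * (K * card ?Z)"
    by (simp add: card_cartesian_product power2_eq_square mult_ac)
  moreover have "real (card H) > 0" using assms(2) by (simp add: card_gt_0_iff)
  ultimately show ?thesis by simp
qed

text \<open>Sum the energies over \<open>t\<close> in \<open>A'\<close> and fix the best
  \<open>b0\<close>. Dependent random choice then applies with
  \<open>\<Omega> = H \<times> A'\<close>, where \<open>(h, t)\<close> is joined to \<open>b\<close>
  if \<open>h - t * (b - b0) \<in> H\<close>.\<close>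

lemma common_differences:
  fixes H A' B :: "'a::{field,finite} set" and K \<zeta> :: real
  assumes ne: "H \<noteq> {}" "A' \<noteq> {}" "B \<noteq> {}" and "K > 0" "\<zeta> \<ge> 0" "N > 0"
    and sat: "\<And>t. t \<in> A' \<Longrightarrow> real (card (H + t *o B)) \<le> K * card H"
    and small: "\<zeta> ^ r * card B ^ N \<le> (1 / K) ^ r * card B / 2"
  obtains b0 B' where "B' \<subseteq> B" "(1 / K) ^ r * card B / 2 \<le> card B'"
    "\<And>bs. set bs \<subseteq> B' \<Longrightarrow> length bs = N \<Longrightarrow>
      \<zeta> * (card H * card A') \<le> card {(h, t). h \<in> H \<and> t \<in> A' \<and> (\<forall>b\<in>set bs. h - t * (b - b0) \<in> H)}"
proof -
  define Z where "Z b0 = {(w, b). w \<in> H \<times> A' \<and> b \<in> B \<and> fst w - snd w * (b - b0) \<in> H}" for b0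
  define V where "V t = {(h, b, b0). h \<in> H \<and> b \<in> B \<and> b0 \<in> B \<and> h - t * (b - b0) \<in> H}" for t
  have "(\<Sum>t\<in>A'. card (V t)) = card (SIGMA t:A'. V t)" by simp
  also have "\<dots> \<le> card (SIGMA b0:B. Z b0)"
    by (rule card_inj_on_le[of "\<lambda>(t, h, b, b0). (b0, (h, t), b)"]) (auto simp: inj_on_def Z_def V_def)
  also have "\<dots> = (\<Sum>b0\<in>B. card (Z b0))" by simp
  finally have VZ: "(\<Sum>t\<in>A'. real (card (V t))) \<le> (\<Sum>b0\<in>B. real (card (Z b0)))"
    by (simp flip: of_nat_sum)
  have "(\<Sum>t\<in>A'. real (card H) * (card B)\<^sup>2 / K) \<le> (\<Sum>t\<in>A'. real (card (V t)))"
    using dilate_energy[OF sat ne(1)] assms(4)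
    by (intro sum_mono) (simp add: V_def field_simps)
  then have low: "card A' * (real (card H) * (card B)\<^sup>2 / K) \<le> (\<Sum>b0\<in>B. real (card (Z b0)))"
    using VZ by simp
  have "\<exists>b0\<in>B. 1 / K * (card H * card A') * card B \<le> card (Z b0)"
  proof (rule ccontr)
    assume "\<not> ?thesis"
    then have "(\<Sum>b0\<in>B. real (card (Z b0))) < (\<Sum>b0\<in>B. 1 / K * (card H * card A') * card B)"
      using ne(3) by (intro sum_strict_mono) auto
    also have "\<dots> = card A' * (real (card H) * (card B)\<^sup>2 / K)"
      by (simp add: power2_eq_square field_simps)
    finally show False using low by linarith
  qed
  then obtain b0 where b0: "1 / K * (card H * card A') * card B \<le> card (Z b0)" by blast
  define G where "G w b \<longleftrightarrow> fst w - snd w * (b - b0) \<in> H" for w b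
  have dens: "1 / K * card (H \<times> A') * card B \<le> card {(w, b). w \<in> H \<times> A' \<and> b \<in> B \<and> G w b}"
    using b0 by (simp add: Z_def G_def card_cartesian_product)
  have HA: "H \<times> A' \<noteq> {}" using ne by auto
  obtain B' where B': "B' \<subseteq> B" "(1 / K) ^ r * card B / 2 \<le> card B'"
    "\<And>bs. set bs \<subseteq> B' \<Longrightarrow> length bs = N \<Longrightarrow>
      \<zeta> * card (H \<times> A') \<le> card {w \<in> H \<times> A'. \<forall>b\<in>set bs. G w b}"
    using dependent_random_choice[OF _ _ HA \<open>N > 0\<close> _ \<open>\<zeta> \<ge> 0\<close> dens small] \<open>K > 0\<close> by auto
  have "{w \<in> H \<times> A'. \<forall>b\<in>set bs. G w b} = {(h, t). h \<in> H \<and> t \<in> A' \<and> (\<forall>b\<in>set bs. h - t * (b - b0) \<in> H)}" for bs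
    by (auto simp: G_def)
  then show ?thesis using that[OF B'(1,2), of b0] B'(3) by (simp add: card_cartesian_product)
qed

text \<open>In the manner of Ruzsa's triangle inequality:
  \<open>h + y * d = (h - t * y) + y * (t + d)\<close> for every admissible \<open>t\<close>, so
  each element of the sum has at least \<open>\<rho>\<close> representations by pairs in
  \<open>H \<times> (A' + D)\<close>.\<close>

lemma card_plus_dilate_le:
  fixes H X A' D :: "'a::{field,finite} set" and \<rho> :: real
  assumes "\<And>h. h \<in> X \<Longrightarrow> \<rho> \<le> card {t \<in> A'. h - t * y \<in> H}"
  shows "\<rho> * card (X + y *o D) \<le> card H * card (A' + D)"
proof -
  define W where "W z = {(u, w). u \<in> H \<and> w \<in> A' + D \<and> u + y * w = z}" for z
  have "\<rho> \<le> card (W z)" if z: "z \<in> X + y *o D" for z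
  proof -
    obtain h d where hd: "h \<in> X" "d \<in> D" "z = h + y * d"
      using z by (auto simp: elt_set_times_def elim!: set_plus_elim)
    have "card {t \<in> A'. h - t * y \<in> H} \<le> card (W z)"
    proof (rule card_inj_on_le[of "\<lambda>t. (h - t * y, t + d)"])
      show "(\<lambda>t. (h - t * y, t + d)) ` {t \<in> A'. h - t * y \<in> H} \<subseteq> W z"
        using hd by (auto simp: W_def algebra_simps)
    qed (auto simp: inj_on_def)
    then show ?thesis using assms[OF hd(1)] by linarith
  qed
  then have "(\<Sum>z\<in>X + y *o D. \<rho>) \<le> (\<Sum>z\<in>X + y *o D. real (card (W z)))" by (rule sum_mono)
  then have "\<rho> * card (X + y *o D) \<le> real (\<Sum>z\<in>X + y *o D. card (W z))" by (simp add: mult.commute)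
  also have "(\<Sum>z\<in>X + y *o D. card (W z)) = card (\<Union>z\<in>X + y *o D. W z)"
    by (rule card_UN_disjoint[symmetric]) (auto simp: W_def)
  also have "real \<dots> \<le> real (card (H \<times> (A' + D)))"
    by (intro of_nat_mono card_mono) (auto simp: W_def)
  finally show ?thesis by (simp add: card_cartesian_product)
qed

subsection \<open>The lower bound\<close>

text \<open>The e-transform started at \<open>(A, B')\<close> gives a set of size
  \<open>card U\<close> inside a translate of a sum of at most \<open>N\<close> sets from
  \<open>\<C>\<close>, and Plunnecke compares that sum with \<open>H\<close>. Hence at most
  \<open>N\<close> elements of \<open>B'\<close> must be controlled at once.\<close>

lemma saturated_sum_lower_bound:
  fixes A B H A' :: "'p::prime_card mod_ring set" and K s p :: real
  assumes p: "p = CARD('p)" "exp 1 \<le> p" and a: "a \<in> A" "a \<noteq> 0"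
    and ne: "H \<noteq> {}" "A' \<noteq> {}" "B \<noteq> {}"
    and satA: "\<And>D. D \<in> {A, uminus ` A} \<Longrightarrow> real (card (A' + D)) \<le> p powr s * card A'"
    and satH: "\<And>t. t \<in> A' \<union> A \<union> uminus ` A \<Longrightarrow> real (card (H + t *o B)) \<le> K * card H"
    and K: "0 < K" "K \<le> p powr s" and s: "0 < s" "s \<le> 1" and N: "N = 2 ^ Suc i"
    and small: "(p powr - (s\<^sup>2)) ^ r * card B ^ N \<le> (1 / K) ^ r * card B / 2"
    and big: "1 < (1 / K) ^ r * card B / 2"
  shows "min ((1 / K) ^ r * (card A * card B) / (8 * p powr (1 / 2 ^ i))) (p / 2)
    \<le> (p powr (5 * s)) ^ (N * N) * card H"
proof -
  have p1: "p \<ge> 1" using p(2) exp_ge_add_one_self[of 1] by linarith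
  have "N > 0" by (simp add: N)
  have z0: "p powr - (s\<^sup>2) \<ge> 0" by simp
  have satA': "real (card (H + t *o B)) \<le> K * card H" if "t \<in> A'" for t using satH that by simp
  obtain b0 B' where B': "B' \<subseteq> B" "(1 / K) ^ r * card B / 2 \<le> card B'"
    and common: "\<And>bs. set bs \<subseteq> B' \<Longrightarrow> length bs = N \<Longrightarrow> p powr - (s\<^sup>2) * (card H * card A')
      \<le> card {(h, t). h \<in> H \<and> t \<in> A' \<and> (\<forall>b\<in>set bs. h - t * (b - b0) \<in> H)}"
    by (rule common_differences[OF ne K(1) z0 \<open>N > 0\<close> satA' small]) (assumption, rule that)
  have cB': "card B' \<ge> 2" using B'(2) big by linarith
  define \<C> where "\<C> = {t *o B | t. t \<in> A \<union> uminus ` A} \<union> {(b - b0) *o D | b D. b \<in> B' \<and> D \<in> {A, uminus ` A}}"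
  \<comment> \<open>Each difference splits into two members of \<open>\<C>\<close>, which gives the
    initial 2; the base point \<open>b0\<close> cancels in
    \<open>(b - b0) - (b' - b0)\<close>.\<close>
  have bi: "bi_covered \<C> 2 A B'"
    unfolding bi_covered_def
  proof (intro conjI ballI)
    fix t t' assume t: "t \<in> A" "t' \<in> A"
    then have "t *o B \<in> \<C>" "(- t') *o B \<in> \<C>" by (auto simp: \<C>_def)
    then have "covered \<C> (1 + 1) (t *o B + (- t') *o B)" by (intro covered_plus covered_single)
    moreover have "(t - t') *o B' \<subseteq> t *o B + (- t') *o B"
    proof
      fix y assume "y \<in> (t - t') *o B'"
      then obtain b where "b \<in> B" "y = t * b + (- t') * b"
        using B'(1) by (auto simp: elt_set_times_def algebra_simps)
      then show "y \<in> t *o B + (- t') *o B" by blast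
    qed
    ultimately show "covered \<C> 2 ((t - t') *o B')" by (rule covered_mono) simp
  next
    fix b b' assume b: "b \<in> B'" "b' \<in> B'"
    then have "(b - b0) *o A \<in> \<C>" "(b' - b0) *o (uminus ` A) \<in> \<C>" by (auto simp: \<C>_def)
    then have "covered \<C> (1 + 1) ((b - b0) *o A + (b' - b0) *o (uminus ` A))" by (intro covered_plus covered_single)
    moreover have "(b - b') *o A \<subseteq> (b - b0) *o A + (b' - b0) *o (uminus ` A)"
    proof
      fix y assume "y \<in> (b - b') *o A"
      then obtain c where "c \<in> A" "y = (b - b0) * c + (b' - b0) * (- c)"
        by (auto simp: elt_set_times_def algebra_simps)
      then show "y \<in> (b - b0) *o A + (b' - b0) *o (uminus ` A)" by blast
    qed
    ultimately show "covered \<C> 2 ((b - b') *o A)" by (rule covered_mono) simp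
  qed
  have "a *o B \<in> \<C>" using a by (auto simp: \<C>_def)
  then have "covered \<C> 2 (a *o B')"
    using covered_mono[OF covered_single set_times_mono[OF B'(1)]] by simp
  then obtain U Y :: "'p mod_ring set" where Y: "covered \<C> N Y" "card Y = card U" and
    U: "real (card A * card B') \<le> 4 * CARD('p) powr (1 / 2 ^ i) * card U \<or> CARD('p) / 2 \<le> card U"
    using e_transform_iteration[OF bi cB' a(2), of i] unfolding N by blast
  obtain Cs z where Cs: "length Cs \<le> N" "set Cs \<subseteq> \<C>" "Y \<subseteq> z +o sum_list Cs"
    using Y(1) unfolding covered_def by blast
  have "card Y \<le> card (sum_list Cs)"
    using card_mono[OF _ Cs(3)] by (simp add: card_translate)
  moreover have "real (card (sum_list Cs)) \<le> (p powr (5 * s)) ^ (N * N) * card H"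
  proof -
    define \<theta> where "\<theta> = p powr (- 2 * s)"
    have \<theta>: "\<theta> > 0" using p1 by (simp add: \<theta>_def)
    have Apos: "real (card A') > 0" and Hpos: "real (card H) > 0" using ne by (simp_all add: card_gt_0_iff)
    obtain b1 where b1: "b1 \<in> B'" using cB' by fastforce
    \<comment> \<open>For a summand of the form \<open>(b - b0) *o D\<close> this selects one such
      \<open>b\<close>, otherwise any element of \<open>B'\<close>. The list \<open>bs\<close> is
      then padded to length exactly \<open>N\<close>, as \<open>common\<close> demands.\<close>
    define g where "g C = (SOME b. b \<in> B' \<and> ((\<exists>b\<in>B'. \<exists>D\<in>{A, uminus ` A}. C = (b - b0) *o D) \<longrightarrow>
      (\<exists>D\<in>{A, uminus ` A}. C = (b - b0) *o D)))" for C
    have g: "g C \<in> B' \<and> ((\<exists>b\<in>B'. \<exists>D\<in>{A, uminus ` A}. C = (b - b0) *o D) \<longrightarrow>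
      (\<exists>D\<in>{A, uminus ` A}. C = (g C - b0) *o D))" for C
      unfolding g_def by (rule someI_ex) (use b1 in blast)
    define bs where "bs = map g Cs @ replicate (N - length Cs) b1"
    have bs: "set bs \<subseteq> B'" "length bs = N" using g b1 Cs(1) by (auto simp: bs_def)
    define F where "F h = {t \<in> A'. \<forall>b\<in>set bs. h - t * (b - b0) \<in> H}" for h
    \<comment> \<open>These \<open>h\<close> have many \<open>t\<close> that are good for all
      entries of \<open>bs\<close> simultaneously; Plunnecke is run on \<open>X\<close> in place of
      \<open>H\<close>.\<close>
    define X where "X = {h \<in> H. \<theta> \<le> real (card (F h)) / card A'}"
    have "p powr - (s\<^sup>2) * (card H * card A') \<le> card (SIGMA h:H. F h)"
    proof -
      have "{(h, t). h \<in> H \<and> t \<in> A' \<and> (\<forall>b\<in>set bs. h - t * (b - b0) \<in> H)} = (SIGMA h:H. F h)"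
        by (auto simp: F_def)
      then show ?thesis using common[OF bs] by simp
    qed
    then have "p powr - (s\<^sup>2) * card H \<le> (\<Sum>h\<in>H. real (card (F h)) / card A')"
      using Apos by (simp add: field_simps flip: sum_divide_distrib)
    moreover have "real (card (F h)) / card A' \<le> 1" for h
      using card_mono[of A' "F h"] Apos by (simp add: F_def)
    ultimately have X: "\<theta> * card H \<le> card X"
      unfolding \<theta>_def X_def using p(2) s by (intro many_large_values) auto
    then have "real (card X) > 0" using \<theta> Hpos by (smt (verit) mult_pos_pos)
    then have Xne: "X \<noteq> {}" by auto
    \<comment> \<open>The exponent 3 will consist of 1 for the saturation of \<open>A'\<close> and 2
      for the density \<open>\<theta>\<close>; passing from \<open>H\<close> to \<open>X\<close>
      costs another 2.\<close>
    have pX: "p powr (3 * s) * card H \<le> p powr (5 * s) * card X"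
    proof -
      have "p powr (3 * s) * card H = p powr (5 * s) * (\<theta> * card H)"
        by (simp add: \<theta>_def flip: powr_add mult.assoc)
      also have "\<dots> \<le> p powr (5 * s) * card X" using X by (intro mult_left_mono) auto
      finally show ?thesis .
    qed
    have "real (card (sum_list Cs)) \<le> (p powr (5 * s)) ^ (N * N) * card X"
    proof (rule Plunnecke_sum_list[OF Xne _ Cs(1)])
      show "1 \<le> p powr (5 * s)" using p1 s by (intro ge_one_powr_ge_zero) auto
      fix C assume C: "C \<in> set Cs"
      show "C \<noteq> {}" using C Cs(2) a(1) ne(3) by (auto simp: \<C>_def elt_set_times_def)
      show "real (card (X + C)) \<le> p powr (5 * s) * card X"
      proof (cases "\<exists>b\<in>B'. \<exists>D\<in>{A, uminus ` A}. C = (b - b0) *o D")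
        case True
        then obtain D where D: "D \<in> {A, uminus ` A}" "C = (g C - b0) *o D" using g by blast
        have "g C \<in> set bs" using C by (simp add: bs_def)
        have "\<theta> * card A' \<le> card {t \<in> A'. h - t * (g C - b0) \<in> H}" if "h \<in> X" for h
        proof -
          have "\<theta> * card A' \<le> card (F h)" using that Apos by (simp add: X_def field_simps)
          also have "card (F h) \<le> card {t \<in> A'. h - t * (g C - b0) \<in> H}"
            using \<open>g C \<in> set bs\<close> by (intro card_mono) (auto simp: F_def)
          finally show ?thesis by simp
        qed
        then have "\<theta> * card A' * card (X + (g C - b0) *o D) \<le> card H * card (A' + D)"
          by (rule card_plus_dilate_le)
        also have "\<dots> \<le> card H * (p powr s * card A')"
          using satA[OF D(1)] by (simp add: mult_left_mono)
        finally have "card A' * (\<theta> * card (X + C)) \<le> card A' * (p powr s * card H)"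
          using D(2) by (simp add: mult_ac)
        then have "\<theta> * card (X + C) \<le> p powr s * card H" using Apos by simp
        then have "p powr (2 * s) * (\<theta> * card (X + C)) \<le> p powr (2 * s) * (p powr s * card H)"
          by (intro mult_left_mono) auto
        then have "real (card (X + C)) \<le> p powr (3 * s) * card H"
          using p1 by (simp add: \<theta>_def flip: powr_add mult.assoc)
        then show ?thesis using pX by linarith
      next
        case False
        then obtain t where t: "t \<in> A \<union> uminus ` A" "C = t *o B"
          using C Cs(2) unfolding \<C>_def by blast
        have "card (X + C) \<le> card (H + t *o B)"
          unfolding t(2) by (intro card_mono set_plus_mono2) (auto simp: X_def)
        then have "real (card (X + C)) \<le> K * card H" using satH[of t] t(1) by auto
        also have "\<dots> \<le> p powr (3 * s) * card H"
          using K(2) powr_mono[of s "3 * s" p] p1 s by (intro mult_right_mono) auto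
        finally show ?thesis using pX by linarith
      qed
    qed
    also have "\<dots> \<le> (p powr (5 * s)) ^ (N * N) * card H"
      by (intro mult_left_mono of_nat_mono card_mono) (auto simp: X_def)
    finally show ?thesis .
  qed
  ultimately have UH: "real (card U) \<le> (p powr (5 * s)) ^ (N * N) * card H" using Y(2) by linarith
  define w where "w = p powr (1 / 2 ^ i)"
  have w: "w > 0" using p1 by (simp add: w_def)
  from U show ?thesis
  proof
    assume "real (card A * card B') \<le> 4 * CARD('p) powr (1 / 2 ^ i) * card U"
    then have "card A * real (card B') \<le> 4 * w * card U" by (simp add: w_def p(1))
    moreover have "card A * ((1 / K) ^ r * card B / 2) \<le> card A * real (card B')"
      using B'(2) by (intro mult_left_mono) auto
    ultimately have le: "card A * ((1 / K) ^ r * card B / 2) \<le> 4 * w * card U" by linarith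
    have "(1 / K) ^ r * (card A * card B) / (8 * w) = card A * ((1 / K) ^ r * card B / 2) / (4 * w)"
      by simp
    also have "\<dots> \<le> card U" using le w by (subst pos_divide_le_eq) (auto simp: mult.commute)
    finally have "(1 / K) ^ r * (card A * card B) / (8 * w) \<le> card U" .
    then show ?thesis using UH unfolding w_def by linarith
  next
    assume "CARD('p) / 2 \<le> card U"
    then show ?thesis using UH p(1) by linarith
  qed
qed

section \<open>Choice of parameters\<close>

lemma power_of_powr:
  fixes x u :: real
  assumes "x > 0"
  shows "(x powr u) ^ k = x powr (u * real k)"
  using assms powr_realpow[of "x powr u" k] by (simp add: powr_powr)

theorem theorem1p5:
  fixes p :: nat
    and A B :: "'p::prime_card mod_ring set"
    and \<beta> \<epsilon> :: real
  assumes "p = CARD('p)"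
    and "\<not> A \<subseteq> {0}"
    and "0 < \<beta>" "\<beta> \<le> 1"
    and "0 < \<epsilon>" "\<epsilon> \<le> 1"
    and "real (card B) > real p powr \<beta>"
    and "real p powr \<beta> > 4"
  shows "\<exists>k::nat. 1 \<le> k \<and> real k \<le> exp (122 * max (1 / \<beta>) (1 / \<epsilon>)) \<and>
           (\<exists>(a :: nat \<Rightarrow> 'p mod_ring) (s :: nat \<Rightarrow> sign).
              (\<forall>i\<in>{1..k}. a i \<in> A) \<and>
              real (card (signed_sumset a s B k))
                \<ge> 1 / 2 ^ 12 * real p powr (- \<epsilon>) * min (real (card A) * real (card B)) (real p))"
proof -
  define x where "x = max (1 / \<beta>) (1 / \<epsilon>)"
  \<comment> \<open>This makes \<open>N\<close> at least \<open>8 * x\<close>, so that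
    \<open>8 / N\<close> is at most \<open>\<beta>\<close> and \<open>\<epsilon>\<close>.\<close>
  define q where "q = nat \<lceil>8 * x\<rceil>"
  define N :: nat where "N = 2 ^ Suc q"
  define P where "P = real p"
  \<comment> \<open>The exponents are matched. With \<open>r = N ^ 8\<close>, \<open>K ^ r\<close>
    is only \<open>P powr (1 / N)\<close>, while the power \<open>r\<close> of
    \<open>P powr - (s\<^sup>2)\<close> has exponent \<open>- (N\<^sup>2)\<close> and beats the
    number of \<open>N\<close>-tuples from \<open>B\<close>. The \<open>N * N\<close> Plunnecke
    factors \<open>P powr (5 * s)\<close> amount to \<open>P powr (5 / N)\<close>.\<close>
  define s where "s = 1 / real (N ^ 3)"
  define K where "K = P powr (1 / real (N ^ 9))"
  have x: "x \<ge> 1" "1 / x \<le> \<beta>" "1 / x \<le> \<epsilon>"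
    using assms(3-6) by (auto simp: x_def field_simps max_def)
  have q: "8 * x \<le> q" "q \<le> 8 * x + 1" using x(1) by (auto simp: q_def)
  have "real (Suc q) \<le> real (2 ^ Suc q)" by (intro of_nat_mono less_imp_le less_exp)
  then have N8: "8 * x \<le> real N" using q unfolding N_def by linarith
  have Npos: "real N > 0" by (simp add: N_def)
  have p4: "P > 4"
  proof -
    have "P \<ge> 1" using assms(1) by (simp add: P_def Suc_le_eq)
    then have "P powr \<beta> \<le> P powr 1" using assms(4) by (intro powr_mono) auto
    then show ?thesis using assms(8) \<open>P \<ge> 1\<close> by (simp add: P_def)
  qed
  have P0: "P > 0" using p4 by simp
  have P: "real CARD('p mod_ring) = P" using assms(1) by (simp add: P_def)
  have pe: "exp 1 \<le> P" using exp_le p4 by linarith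
  have "\<exists>a\<in>A. a \<noteq> 0" using assms(2) by auto
  then obtain a where a: "a \<in> A" "a \<noteq> 0" by auto
  have B: "B \<noteq> {}" using assms(7,8) by auto
  obtain A' where A': "A' \<noteq> {}"
    "\<And>t. t \<in> A' \<Longrightarrow> \<exists>ts. set ts \<subseteq> A \<union> uminus ` A \<and> length ts \<le> N ^ 3 \<and> t = sum_list ts"
    "\<And>D. D \<in> {A, uminus ` A} \<Longrightarrow> real (card (A' + D)) \<le> P powr s * card A'"
  proof (rule saturated_multipliers[of "P powr s" "N ^ 3" A])
    show "real CARD('p mod_ring) \<le> (P powr s) ^ N ^ 3"
      unfolding P power_of_powr[OF P0] s_def using Npos P0 by simp
    show "P powr s > 0" "N ^ 3 > 0" using P0 by (simp_all add: N_def)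
  qed (rule that)
  \<comment> \<open>Besides \<open>A'\<close>, saturation is required for \<open>A\<close> and its
    negatives, whose dilates of \<open>B\<close> also occur as summands; each of these multipliers
    is a one-term sum.\<close>
  define M where "M = A' \<union> A \<union> uminus ` A"
  obtain k H where H: "k \<le> 1 + N ^ 9 * N ^ 3" "is_signed_sum A B k H" "H \<noteq> {}"
    "\<And>t. t \<in> M \<Longrightarrow> real (card (H + t *o B)) \<le> K * card H"
  proof (rule saturated_signed_sum[of K "N ^ 9" A B M "N ^ 3"])
    show "real CARD('p mod_ring) \<le> K ^ N ^ 9"
      unfolding P K_def power_of_powr[OF P0] using Npos P0 by simp
    show "K > 0" "N ^ 9 > 0" "A \<noteq> {}" "B \<noteq> {}" using P0 a B by (auto simp: K_def N_def)
    fix t assume "t \<in> M"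
    then consider "t \<in> A'" | "t \<in> A \<union> uminus ` A" by (auto simp: M_def)
    then show "\<exists>ts. set ts \<subseteq> A \<union> uminus ` A \<and> length ts \<le> N ^ 3 \<and> t = sum_list ts"
    proof cases
      case 2
      moreover have "1 \<le> N ^ 3" by (simp add: N_def)
      ultimately show ?thesis by (intro exI[of _ "[t]"]) auto
    qed (use A'(2) in auto)
  qed (rule that)
  have Kr: "(1 / K) ^ N ^ 8 = P powr (- 1 / N)"
  proof -
    have "1 / K = P powr (- 1 / real (N ^ 9))" by (simp add: K_def powr_minus_divide)
    then have "(1 / K) ^ N ^ 8 = P powr (- 1 / real (N ^ 9) * real (N ^ 8))"
      by (simp only: power_of_powr[OF P0])
    also have "- 1 / real (N ^ 9) * real (N ^ 8) = - 1 / N"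
      using Npos by (simp add: field_simps power_numeral_reduce)
    finally show ?thesis .
  qed
  have N2: "1 / real N \<le> \<beta> / 2" "8 / real N \<le> \<epsilon>"
  proof -
    have "8 / real N \<le> 8 / (8 * x)" using N8 x(1) Npos by (intro divide_left_mono) auto
    then have "8 / real N \<le> 1 / x" by simp
    then show "1 / real N \<le> \<beta> / 2" "8 / real N \<le> \<epsilon>" using x assms(3) by linarith+
  qed
  have "N \<ge> 2" by (simp add: N_def)
  have bound: "min ((1 / K) ^ N ^ 8 * (card A * card B) / (8 * P powr (1 / 2 ^ q))) (P / 2)
      \<le> (P powr (5 * s)) ^ (N * N) * card H"
  proof (rule saturated_sum_lower_bound[OF _ pe a H(3) A'(1) B A'(3)])
    show "P = CARD('p)" using assms(1) by (simp add: P_def)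
    show "real (card (H + t *o B)) \<le> K * card H" if "t \<in> A' \<union> A \<union> uminus ` A" for t
      using H(4) that by (simp add: M_def)
    show "0 < K" using p4 by (simp add: K_def)
    have "real N ^ 3 \<le> real N ^ 9" using \<open>N \<ge> 2\<close> by (intro power_increasing) auto
    then have "1 / real (N ^ 9) \<le> s" unfolding s_def using Npos by (intro divide_left_mono) auto
    then show "K \<le> P powr s" unfolding K_def using p4 by (intro powr_mono) auto
    show "0 < s" "s \<le> 1" using \<open>N \<ge> 2\<close> by (auto simp: s_def)
    show "N = 2 ^ Suc q" by (simp add: N_def)
    \<comment> \<open>Here \<open>P powr \<beta> > 4\<close> enters: half of the exponent pays for
      \<open>K ^ N ^ 8\<close>, and the rest still exceeds 2.\<close>
    have sq: "2 < P powr (\<beta> / 2)"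
    proof (rule ccontr)
      assume "\<not> ?thesis"
      then have "P powr (\<beta> / 2) * P powr (\<beta> / 2) \<le> 2 * 2" by (intro mult_mono) auto
      moreover have "P powr (\<beta> / 2) * P powr (\<beta> / 2) = P powr \<beta>" by (simp flip: powr_add)
      ultimately show False using assms(8) by (simp add: P_def)
    qed
    have "P powr (\<beta> / 2) = P powr (- (\<beta> / 2)) * P powr \<beta>" by (simp flip: powr_add)
    also have "\<dots> \<le> P powr (- 1 / N) * card B"
      using N2(1) p4 assms(7) by (intro mult_mono powr_mono) (auto simp: P_def)
    finally show "1 < (1 / K) ^ N ^ 8 * card B / 2" using sq by (simp add: Kr)
    show "(P powr - (s\<^sup>2)) ^ N ^ 8 * card B ^ N \<le> (1 / K) ^ N ^ 8 * card B / 2"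
    proof -
      have "- (s\<^sup>2) * real (N ^ 8) = - (real N ^ 2)"
        using Npos by (simp add: s_def field_simps power_numeral_reduce power2_eq_square)
      then have e1: "(P powr - (s\<^sup>2)) ^ N ^ 8 = P powr (- (real N ^ 2))"
        by (simp only: power_of_powr[OF P0])
      have "card B \<le> CARD('p mod_ring)" by (intro card_mono) auto
      then have cB: "real (card B) \<le> P" using assms(1) by (simp add: P_def)
      \<comment> \<open>One factor \<open>card B\<close> is set aside, since the right-hand side has
        it too; the others are bounded by \<open>P\<close>. The exponents leave a spare
        \<open>1 / P\<close>, which pays for the 1/2.\<close>
      have "real (card B) ^ N = real (card B) ^ (N - 1) * card B"
        using \<open>N \<ge> 2\<close> by (metis Suc_diff_1 mult.commute power_Suc less_le_trans pos2)
      also have "\<dots> \<le> P powr (real N - 1) * card B"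
      proof (intro mult_right_mono)
        have "real (card B) ^ (N - 1) \<le> P ^ (N - 1)" using cB by (intro power_mono) auto
        also have "\<dots> = P powr (real N - 1)"
          using powr_realpow[OF P0, of "N - 1"] \<open>N \<ge> 2\<close> by (simp add: of_nat_diff)
        finally show "real (card B) ^ (N - 1) \<le> P powr (real N - 1)" .
      qed auto
      finally have "P powr (- (real N ^ 2)) * card B ^ N \<le> P powr (- (real N ^ 2)) * (P powr (real N - 1) * card B)"
        by (intro mult_left_mono) auto
      also have "\<dots> = P powr (- (real N ^ 2) + (real N - 1)) * card B" unfolding powr_add by (rule mult.assoc[symmetric])
      also have "\<dots> \<le> P powr (- 1 / N - 1) * card B"
      proof (intro mult_right_mono powr_mono)
        have "2 * real N \<le> real N * real N" using \<open>N \<ge> 2\<close> by (intro mult_right_mono) auto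
        moreover have "1 / real N \<le> 1" using \<open>N \<ge> 2\<close> by simp
        moreover have "real N \<ge> 2" using \<open>N \<ge> 2\<close> by simp
        ultimately show "- (real N ^ 2) + (real N - 1) \<le> - 1 / N - 1"
          unfolding power2_eq_square by linarith
      qed (use p4 in auto)
      also have "\<dots> = P powr (- 1 / N) * card B / P" using p4 by (simp add: powr_diff)
      also have "\<dots> \<le> P powr (- 1 / N) * card B / 2" using p4 by (intro divide_left_mono) auto
      finally show ?thesis by (simp add: e1 Kr)
    qed
  qed
  have e2: "(P powr (5 * s)) ^ (N * N) = P powr (5 / N)"
  proof -
    have "5 * s * real (N * N) = 5 / N"
      using Npos by (simp add: s_def field_simps power_numeral_reduce)
    then show ?thesis by (simp only: power_of_powr[OF P0])
  qed
  have e3: "1 / 2 ^ q = 2 / real N" by (simp add: N_def)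
  define m where "m = min (real (card A) * real (card B)) P"
  have m0: "m \<ge> 0" using p4 by (simp add: m_def)
  \<comment> \<open>The loss \<open>3 / N\<close> is \<open>1 / N\<close> from passing to
    \<open>B'\<close> and \<open>2 / N = 1 / 2 ^ q\<close> from the e-transform; with
    \<open>5 / N\<close> from Plunnecke the total is \<open>8 / N \<le> \<epsilon>\<close>.\<close>
  have "P powr (- 3 / N) * m / 8 \<le> min ((1 / K) ^ N ^ 8 * (card A * card B) / (8 * P powr (1 / 2 ^ q))) (P / 2)"
  proof (rule min.boundedI)
    have "P powr (- 3 / N) = P powr (- 1 / N) / P powr (2 / N)" by (simp flip: powr_diff)
    then have "(1 / K) ^ N ^ 8 * (card A * card B) / (8 * P powr (1 / 2 ^ q)) = P powr (- 3 / N) * (card A * real (card B)) / 8"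
      unfolding Kr e3 by simp
    moreover have "P powr (- 3 / N) * m \<le> P powr (- 3 / N) * (card A * real (card B))"
      by (intro mult_left_mono) (auto simp: m_def)
    ultimately show "P powr (- 3 / N) * m / 8 \<le> (1 / K) ^ N ^ 8 * (card A * card B) / (8 * P powr (1 / 2 ^ q))"
      by linarith
    have "P powr (- 3 / N) \<le> P powr 0" using p4 by (intro powr_mono) auto
    then have "P powr (- 3 / N) * m \<le> 1 * m" using m0 p4 by (intro mult_right_mono) auto
    then show "P powr (- 3 / N) * m / 8 \<le> P / 2" using p4 unfolding m_def by linarith
  qed
  also have "\<dots> \<le> P powr (5 / N) * card H" using bound by (simp add: e2)
  finally have "P powr (- 5 / N) * (P powr (- 3 / N) * m / 8) \<le> P powr (- 5 / N) * (P powr (5 / N) * card H)"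
    by (intro mult_left_mono) auto
  also have "\<dots> = card H" using p4 by (simp flip: powr_add mult.assoc)
  also have "P powr (- 5 / N) * (P powr (- 3 / N) * m / 8) = P powr (- 8 / N) * m / 8"
    by (simp flip: powr_add mult.assoc)
  finally have "P powr (- 8 / N) * m / 8 \<le> card H" .
  moreover have "P powr (- \<epsilon>) * m \<le> P powr (- 8 / N) * m"
    using N2(2) p4 m0 by (intro mult_right_mono powr_mono) auto
  moreover have "1 / 2 ^ 12 * (P powr (- \<epsilon>) * m) \<le> 1 / 8 * (P powr (- \<epsilon>) * m)"
    using m0 by (intro mult_right_mono) auto
  ultimately have fin: "1 / 2 ^ 12 * P powr (- \<epsilon>) * m \<le> card H" by linarith
  have "real k \<le> exp (122 * x)"
  proof -
    have "1 + N ^ 9 * N ^ 3 \<le> 2 * N ^ 12" using \<open>N \<ge> 2\<close> by (simp flip: power_add)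
    then have "k \<le> 2 * N ^ 12" using H(1) by linarith
    then have "real k \<le> real (2 * N ^ 12)" by (rule of_nat_mono)
    also have "2 * N ^ 12 = 2 ^ (12 * q + 13)" by (simp add: N_def power_add power_mult_distrib flip: power_mult) 
    also have "real \<dots> \<le> exp 1 ^ (12 * q + 13)"
      using exp_ge_add_one_self[of 1] by (simp add: power_mono)
    also have "\<dots> = exp (real (12 * q + 13))" by (simp flip: exp_of_nat_mult)
    \<comment> \<open>Since \<open>q \<le> 8 * x + 1\<close> and \<open>x \<ge> 1\<close>, the
      exponent is at most \<open>96 * x + 25 \<le> 121 * x\<close>.\<close>
    also have "\<dots> \<le> exp (122 * x)" using q x(1) by simp
    finally show ?thesis .
  qed
  moreover obtain a s where "\<forall>i\<in>{1..k}. a i \<in> A" "signed_sumset a s B k = H" "1 \<le> k"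
    using H(2) unfolding is_signed_sum_def by blast
  ultimately show ?thesis using fin unfolding x_def m_def P_def by blast
qed

end
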